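(* Let $b\geqslant 2$ be an integer, let $\alpha_1,\alpha_2>0$ and let $y\in\mathbb{R}$. Set $$K_{\alpha_1,\alpha_2}(y)=\left(\left[0,\frac{\alpha_1}{\Delta^b(y)}\right]\times\left[0,\frac{\alpha_2}{\Delta^b(y)}\right]\right)\cup\left\{(H_1,H_2):\ H_1\in[0,\alpha_1]\ \text{and}\ H_2=\frac{\alpha_2}{\alpha_1}H_1\right\}.$$ Then the bivariate multifractal spectrum of the Lévy function $L_{\alpha_1}^b$ and the translated Lévy function $L_{\alpha_2}^{b,y}$ satisfies $$\mathcal{D}_{L_{\alpha_1}^b,L_{\alpha_2}^{b,y}}(H_1,H_2)=\begin{cases}\min\left\{\dfrac{H_1}{\alpha_1},\dfrac{H_2}{\alpha_2}\right\}, & \text{if } (H_1,H_2)\in K_{\alpha_1,\alpha_2}(y),\\[2ex] -\infty, & \text{if } (H_1,H_2)\notin[0,\alpha_1]\times[0,\alpha_2].\end{cases}$$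
   Context: Saw-tooth function: $\{x\}=x-\lfloor x\rfloor-\tfrac12$ if $x\notin\mathbb{Z}$ and $\{x\}=0$ if $x\in\mathbb{Z}$. For $\alpha>0$, an integer $b\geqslant2$ and $y\in\mathbb{R}$, the Lévy function and the translated Lévy function are, for $x\in\mathbb{R}$, $$L_\alpha^b(x)=\sum_{i=1}^\infty\frac{\{b^ix\}}{b^{\alpha i}},\qquad L_\alpha^{b,y}(x)=\sum_{i=1}^\infty\frac{\{b^i(x-y)\}}{b^{\alpha i}}=L_\alpha^b(x-y).$$ Hölder exponent: for a locally bounded $f:\mathbb{R}\to\mathbb{R}$, $\alpha>0$ and $x_0\in\mathbb{R}$, $f\in C^\alpha(x_0)$ if there exist $C>0$, $r>0$ and a polynomial $P$ with $\deg P<\alpha$ such that $|f(x)-P(x-x_0)|\leqslant C|x-x_0|^\alpha$ for all $x\in[x_0-r,x_0+r]$. The Hölder exponent is $h_f(x_0)=\sup\{\alpha\geqslant0: f\in C^\alpha(x_0)\}$ (equal to $0$ if $f\in C^\alpha(x_0)$ for no $\alpha>0$). Bivariate multifractal spectrum: for functions $f,g$ and reals $H_1,H_2$, $\mathcal{D}_{f,g}(H_1,H_2)=\dim_H\{x\in\mathbb{R}: h_f(x)=H_1,\ h_g(x)=H_2\}$, where $\dim_H$ is the Hausdorff dimension, with the convention $\dim_H(\emptyset)=-\infty$. $b$-adic approximation exponent: for $x\in\mathbb{R}$, $$\Delta^b(x)=\sup\left\{\alpha\geqslant1:\ \|b^nx\|\leqslant b^{-n(\alpha-1)}\ \text{for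 infinitely many } n\in\mathbb{N}\right\}\in[1,+\infty],$$ where $\|\cdot\|$ denotes the distance to the nearest integer. If $\Delta^b(y)=+\infty$, then $\alpha_i/\Delta^b(y)$ is understood as $0$. *)

theory Defs
  imports "HOL-Analysis.Analysis"
begin

definition sawtooth :: "real \<Rightarrow> real" where
  "sawtooth x = (if x \<in> \<int> then 0 else x - of_int \<lfloor>x\<rfloor> - 1/2)"

(* The series runs over exponents 1, 2, ...; hence the shift by Suc. *)
definition levy :: "nat \<Rightarrow> real \<Rightarrow> real \<Rightarrow> real" where
  "levy b \<alpha> x = (\<Sum>i. sawtooth (real b ^ Suc i * x) / real b powr (\<alpha> * real (Suc i)))"

definition levy_translated :: "nat \<Rightarrow> real \<Rightarrow> real \<Rightarrow> real \<Rightarrow> real" where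
  "levy_translated b \<alpha> y x =
     (\<Sum>i. sawtooth (real b ^ Suc i * (x - y)) / real b powr (\<alpha> * real (Suc i)))"

(* Meant for \<alpha> > 0; the zero polynomial, of library degree 0, is then always admissible. *)
definition pointwise_holder :: "(real \<Rightarrow> real) \<Rightarrow> real \<Rightarrow> real \<Rightarrow> bool" where
  "pointwise_holder f \<alpha> x0 \<longleftrightarrow>
     (\<exists>C>0. \<exists>r>0. \<exists>P::real poly. real (degree P) < \<alpha> \<and>
        (\<forall>x\<in>{x0 - r..x0 + r}. \<bar>f x - poly P (x - x0)\<bar> \<le> C * \<bar>x - x0\<bar> powr \<alpha>))"

(* Inserting 0 gives the value 0 when the condition holds for no \<alpha> > 0. The value may be \<infinity>. *)
definition holder_exponent :: "(real \<Rightarrow> real) \<Rightarrow> real \<Rightarrow> ereal" where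
  "holder_exponent f x0 = Sup (insert 0 (ereal ` {\<alpha>. \<alpha> > 0 \<and> pointwise_holder f \<alpha> x0}))"

(* diam(U)^s with diam(U)^0 = 1 for nonempty U; needed because 0 powr 0 = 0. *)
definition diam_powr :: "real \<Rightarrow> 'a::metric_space set \<Rightarrow> real" where
  "diam_powr s U = (if U = {} then 0 else if s = 0 then 1 else diameter U powr s)"

(* Boundedness is required explicitly since diameter is unspecified on unbounded sets. *)
definition hausdorff_premeasure :: "real \<Rightarrow> real \<Rightarrow> 'a::metric_space set \<Rightarrow> ennreal" where
  "hausdorff_premeasure s \<delta> A =
     Inf {(\<Sum>i. ennreal (diam_powr s (U i))) | U :: nat \<Rightarrow> 'a set.
            A \<subseteq> (\<Union>i. U i) \<and> (\<forall>i. bounded (U i) \<and> diameter (U i) \<le> \<delta>)}"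

definition hausdorff_measure :: "real \<Rightarrow> 'a::metric_space set \<Rightarrow> ennreal" where
  "hausdorff_measure s A = (SUP \<delta>\<in>{0<..}. hausdorff_premeasure s \<delta> A)"

definition hausdorff_dim :: "'a::metric_space set \<Rightarrow> ereal" where
  "hausdorff_dim A =
     (if A = {} then -\<infinity> else Inf (ereal ` {s. 0 \<le> s \<and> hausdorff_measure s A = 0}))"

definition bivariate_spectrum ::
  "(real \<Rightarrow> real) \<Rightarrow> (real \<Rightarrow> real) \<Rightarrow> real \<Rightarrow> real \<Rightarrow> ereal" where
  "bivariate_spectrum f g H1 H2 =
     hausdorff_dim {x. holder_exponent f x = ereal H1 \<and> holder_exponent g x = ereal H2}"

definition dist_nearest_int :: "real \<Rightarrow> real" where
  "dist_nearest_int x = infdist x \<int>"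

definition approx_exponent :: "nat \<Rightarrow> real \<Rightarrow> ereal" where
  "approx_exponent b x =
     Sup (ereal ` {\<alpha>. 1 \<le> \<alpha> \<and>
       infinite {n::nat. dist_nearest_int (real b ^ n * x) \<le> real b powr (- real n * (\<alpha> - 1))}})"

(* In ereal, \<alpha> / \<infinity> = 0; the exponent is at least 1, so both quotients are finite. *)
definition levy_region :: "nat \<Rightarrow> real \<Rightarrow> real \<Rightarrow> real \<Rightarrow> (real \<times> real) set" where
  "levy_region b \<alpha>1 \<alpha>2 y =
     {0..real_of_ereal (ereal \<alpha>1 / approx_exponent b y)} \<times>
     {0..real_of_ereal (ereal \<alpha>2 / approx_exponent b y)}
     \<union> {(H1, H2). H1 \<in> {0..\<alpha>1} \<and> H2 = \<alpha>2 / \<alpha>1 * H1}"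

end

theory Submission
  imports Defs
begin

text \<open>
  The jump of the Levy function at \<open>k / b ^ l\<close> has size about \<open>b powr (- \<alpha> l)\<close>, which bounds the
  Hoelder exponent at \<open>x\<close> above by \<open>\<alpha> / \<Delta> x\<close>, where \<open>\<Delta>\<close> is the approximation exponent. It is equal to it, because
  between \<open>x\<close> and a point at distance about \<open>b powr (- n D)\<close> with \<open>D > \<Delta> x\<close> there is no jump of generation
  at most \<open>n\<close>: there the first \<open>n\<close> terms are affine. So the spectrum is the dimension of
  \<open>{x. \<Delta> x = \<delta>1 \<and> \<Delta> (x - y) = \<delta>2}\<close> with \<open>\<delta>1 = \<alpha>1 / H1\<close> and \<open>\<delta>2 = \<alpha>2 / H2\<close>. The larger of the two exponents
  alone bounds the dimension above by its reciprocal.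

  For the lower bound, let \<open>\<delta>1 \<ge> \<delta>2\<close>, work in a large base \<open>B = b ^ K\<close> and choose the digits of \<open>x\<close> freely, apart
  from a bounded number of forbidden ones, except in sparse windows \<open>[n, \<delta>1 n)\<close> and \<open>[m, \<delta>2 m)\<close>, where \<open>x\<close> copies the
  digits of \<open>0\<close> and of \<open>y\<close> respectively. Forbidding the digits close to those of \<open>0\<close> and \<open>y\<close> prevents unwanted
  approximations at free levels; inside a window of the first kind \<open>x - y\<close> is approximated as
  \<open>- y\<close> is, which is harmless if \<open>\<Delta> y \<le> \<delta>2\<close>. The free digits parametrise the resulting set by the unit
  interval, with a Hoelder continuous inverse.
\<close>

section \<open>The approximation exponent\<close>

lemma dist_nearest_int_eq: "dist_nearest_int x = \<bar>x - of_int (round x)\<bar>"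
proof (rule antisym)
  show "dist_nearest_int x \<le> \<bar>x - of_int (round x)\<bar>"
    unfolding dist_nearest_int_def using infdist_le[of "of_int (round x)" "\<int>::real set" x]
    by (simp add: dist_real_def)
  show "\<bar>x - of_int (round x)\<bar> \<le> dist_nearest_int x"
    unfolding dist_nearest_int_def infdist_def
    by (auto simp: dist_real_def Ints_def image_iff intro!: cINF_greatest round_diff_minimal)
qed

lemma dist_nearest_int_le: "dist_nearest_int x \<le> \<bar>x - of_int k\<bar>"
  unfolding dist_nearest_int_eq by (rule round_diff_minimal)

lemma dist_nearest_int_nonneg: "0 \<le> dist_nearest_int x"
  by (simp add: dist_nearest_int_eq)

lemma dist_nearest_int_le_half: "dist_nearest_int x \<le> 1/2"
  unfolding dist_nearest_int_eq using of_int_round_abs_le[of x] by (simp add: abs_minus_commute)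

lemma dist_nearest_int_mult: "dist_nearest_int (real m * x) \<le> real m * dist_nearest_int x"
proof -
  have "dist_nearest_int (real m * x) \<le> \<bar>real m * x - of_int (int m * round x)\<bar>"
    by (rule dist_nearest_int_le)
  also have "\<dots> = \<bar>real m * (x - of_int (round x))\<bar>" by (simp add: algebra_simps)
  also have "\<dots> = real m * dist_nearest_int x" by (simp add: dist_nearest_int_eq abs_mult)
  finally show ?thesis .
qed

lemma dist_nearest_int_minus: "dist_nearest_int (- x) = dist_nearest_int x"
proof -
  have "dist_nearest_int (- z) \<le> dist_nearest_int z" for z
    using dist_nearest_int_le[of "- z" "- round z"] by (simp add: dist_nearest_int_eq)
  from this[of x] this[of "- x"] show ?thesis by simp
qed

lemma dist_nearest_int_add: "dist_nearest_int (x + y) \<le> dist_nearest_int x + dist_nearest_int y"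
proof -
  have "dist_nearest_int (x + y) \<le> \<bar>(x + y) - of_int (round x + round y)\<bar>"
    by (rule dist_nearest_int_le)
  also have "\<dots> \<le> \<bar>x - of_int (round x)\<bar> + \<bar>y - of_int (round y)\<bar>" by simp
  finally show ?thesis by (simp add: dist_nearest_int_eq)
qed

lemma dist_nearest_int_add_int: "dist_nearest_int (x + of_int k) = dist_nearest_int x"
proof -
  have "dist_nearest_int (x + of_int k) \<le> dist_nearest_int x" for x k
    using dist_nearest_int_le[of "x + of_int k" "round x + k"] by (simp add: dist_nearest_int_eq)
  from this[of x k] this[of "x + of_int k" "- k"] show ?thesis by simp
qed

lemma dist_nearest_int_geI:
  assumes "c \<le> \<bar>x\<bar>" "\<bar>x\<bar> \<le> 1 - c" "0 \<le> c"
  shows "c \<le> dist_nearest_int x"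
proof -
  let ?k = "round x"
  consider "?k = 0" | "?k \<ge> 1" | "?k \<le> -1" by linarith
  then show ?thesis
  proof cases
    case 1 then show ?thesis using assms by (simp add: dist_nearest_int_eq)
  next
    case 2
    then have "real_of_int ?k \<ge> 1" by simp
    then show ?thesis using assms unfolding dist_nearest_int_eq by linarith
  next
    case 3
    then have "real_of_int ?k \<le> -1" by simp
    then show ?thesis using assms unfolding dist_nearest_int_eq by linarith
  qed
qed

section \<open>Criteria for the approximation exponent and its invariance under powers of the
  base\<close>

lemma approx_exponent_ge_1: "b \<ge> 2 \<Longrightarrow> 1 \<le> approx_exponent b x"
proof -
  assume "b \<ge> 2"
  moreover have "dist_nearest_int z \<le> 1" for z
    using dist_nearest_int_le_half[of z] by simp
  ultimately show ?thesis
    unfolding approx_exponent_def one_ereal_def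
    by (intro Sup_upper imageI) simp
qed

lemma approx_exponent_gtD:
  assumes "b \<ge> 2" "ereal a < approx_exponent b x"
  shows "infinite {n. dist_nearest_int (real b ^ n * x) \<le> real b powr (- real n * (a - 1))}"
proof -
  obtain c where c: "a < c"
    "infinite {n. dist_nearest_int (real b ^ n * x) \<le> real b powr (- real n * (c - 1))}"
    using assms(2) unfolding approx_exponent_def less_Sup_iff by auto
  have "real b powr (- real n * (c - 1)) \<le> real b powr (- real n * (a - 1))" for n
    using assms c by (intro powr_mono) (auto intro: mult_left_mono)
  then have "{n. dist_nearest_int (real b ^ n * x) \<le> real b powr (- real n * (c - 1))}
    \<subseteq> {n. dist_nearest_int (real b ^ n * x) \<le> real b powr (- real n * (a - 1))}"
    by (auto intro: order_trans)
  with c(2) show ?thesis using finite_subset by blast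
qed

lemma approx_exponent_lessD:
  assumes "b \<ge> 2" "approx_exponent b x < ereal a"
  shows "\<forall>\<^sub>F n in sequentially. real b powr (- real n * (a - 1)) < dist_nearest_int (real b ^ n * x)"
proof -
  \<comment> \<open>The supremum ranges only over exponents at least 1, so \<open>a\<close> has to
    lie in that range before finiteness of its solution set can be read off.\<close>
  have "1 \<le> a" using approx_exponent_ge_1[OF assms(1), of x] assms(2)
    by (metis ereal_less_eq(3) less_imp_le one_ereal_def order_trans)
  then have "finite {n. dist_nearest_int (real b ^ n * x) \<le> real b powr (- real n * (a - 1))}"
    using assms(2) unfolding approx_exponent_def
    by (metis (mono_tags, lifting) Sup_upper image_eqI leD mem_Collect_eq)
  then show ?thesis
    by (simp add: not_less flip: cofinite_eq_sequentially eventually_cofinite)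
       (simp add: eventually_cofinite not_less)
qed

lemma approx_exponent_leI:
  assumes "\<And>a. \<delta> < ereal a \<Longrightarrow>
    \<forall>\<^sub>F n in sequentially. real b powr (- real n * (a - 1)) < dist_nearest_int (real b ^ n * x)"
  shows "approx_exponent b x \<le> \<delta>"
  unfolding approx_exponent_def
proof (rule Sup_least, clarify)
  fix a :: real
  assume inf: "infinite {n. dist_nearest_int (real b ^ n * x) \<le> real b powr (- real n * (a - 1))}"
  show "ereal a \<le> \<delta>"
  proof (rule ccontr)
    assume "\<not> ereal a \<le> \<delta>"
    then have "\<forall>\<^sub>F n in sequentially. real b powr (- real n * (a - 1)) < dist_nearest_int (real b ^ n * x)"
      by (intro assms) auto
    then show False using inf
      by (simp add: eventually_cofinite not_less flip: cofinite_eq_sequentially)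
  qed
qed

lemma approx_exponent_geI:
  assumes "b \<ge> 2" "\<And>a. 1 \<le> a \<Longrightarrow> ereal a < \<delta> \<Longrightarrow>
    infinite {n. dist_nearest_int (real b ^ n * x) \<le> real b powr (- real n * (a - 1))}"
  shows "\<delta> \<le> approx_exponent b x"
proof (rule ccontr)
  assume "\<not> \<delta> \<le> approx_exponent b x"
  then obtain z where z: "approx_exponent b x < ereal z" "ereal z < \<delta>"
    using ereal_dense2[of "approx_exponent b x" \<delta>] by (auto simp: not_le)
  have "1 \<le> z" using approx_exponent_ge_1[OF assms(1), of x] z(1)
    by (metis ereal_less_eq(3) less_imp_le one_ereal_def order_trans)
  with assms(2) z have "ereal z \<le> approx_exponent b x"
    unfolding approx_exponent_def by (intro Sup_upper) auto
  with z show False by auto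
qed

lemma approx_exponent_minus: "approx_exponent b (- x) = approx_exponent b x"
  by (simp add: approx_exponent_def dist_nearest_int_minus)

text \<open>The levels of base \<open>b ^ K\<close> are the multiples of \<open>K\<close> among
  those of base \<open>b\<close>. A general level \<open>m\<close> is compared with the next
  multiple of \<open>K\<close>: multiplying by at most \<open>b ^ K\<close> enlarges the distance by
  at most that factor, which any loss in the exponent absorbs for large \<open>m\<close>. This
  permits working in a large base.\<close>

lemma approx_exponent_power:
  assumes "b \<ge> 2" "K \<ge> 1"
  shows "approx_exponent (b ^ K) x = approx_exponent b x"
proof (rule antisym)
  have bK: "b ^ K \<ge> 2" using assms
    by (metis One_nat_def Suc_le_eq numeral_2_eq_2 one_less_power less_le_trans)
  have pw: "real (b ^ K) powr t = real b powr (real K * t)" for t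
    using assms by (simp add: powr_powr flip: powr_realpow)
  show "approx_exponent (b ^ K) x \<le> approx_exponent b x"
  proof (rule approx_exponent_geI)
    fix a assume a: "ereal a < approx_exponent (b ^ K) x"
    have "infinite ((*) K ` {n. dist_nearest_int (real (b ^ K) ^ n * x) \<le> real (b ^ K) powr (- real n * (a - 1))})"
      using approx_exponent_gtD[OF bK a] assms by (subst finite_image_iff) (auto simp: inj_on_def)
    moreover have "(*) K ` {n. dist_nearest_int (real (b ^ K) ^ n * x) \<le> real (b ^ K) powr (- real n * (a - 1))}
      \<subseteq> {n. dist_nearest_int (real b ^ n * x) \<le> real b powr (- real n * (a - 1))}"
      by (auto simp: pw power_mult mult.assoc simp del: of_nat_power) (simp add: of_nat_power)
    ultimately show "infinite {n. dist_nearest_int (real b ^ n * x) \<le> real b powr (- real n * (a - 1))}"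
      using finite_subset by blast
  qed fact
  show "approx_exponent b x \<le> approx_exponent (b ^ K) x"
  proof (rule approx_exponent_leI)
    fix a assume a: "approx_exponent (b ^ K) x < ereal a"
    then obtain c where c: "approx_exponent (b ^ K) x < ereal c" "ereal c < ereal a"
      using ereal_dense2 by blast
    have c1: "1 \<le> c" using approx_exponent_ge_1[OF bK, of x] c(1)
      by (metis ereal_less_eq(3) less_imp_le one_ereal_def order_trans)
    obtain N where N: "\<And>n. n \<ge> N \<Longrightarrow>
        real (b ^ K) powr (- real n * (c - 1)) < dist_nearest_int (real (b ^ K) ^ n * x)"
      using approx_exponent_lessD[OF bK c(1)] unfolding eventually_sequentially by auto
    \<comment> \<open>The first entry puts the next multiple of \<open>K\<close> at or beyond
      \<open>K * N\<close>; the second yields \<open>K * c \<le> m * (a - c)\<close>, which pays for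
      the factor \<open>b ^ K\<close> and for rounding \<open>m\<close> up.\<close>
    define m0 where "m0 = max (K * N) (nat \<lceil>K * c / (a - c)\<rceil>)"
    have "real b powr (- real m * (a - 1)) < dist_nearest_int (real b ^ m * x)" if m: "m \<ge> m0" for m
    proof -
      define j where "j = m div K + 1"
      have jm: "m \<le> K * j" "K * j \<le> m + K"
        proof -
        have "m = K * (m div K) + m mod K" "m mod K < K" using assms by auto
        then show "m \<le> K * j" "K * j \<le> m + K"
          unfolding j_def distrib_left by linarith+
      qed
      have "K * N \<le> K * j"
        by (rule order_trans[OF _ jm(1)]) (use m in \<open>simp add: m0_def\<close>)
      then have "N \<le> j" using assms by simp
      note N[OF this]
      also have "real (b ^ K) ^ j * x = real (b ^ (K * j - m)) * (real b ^ m * x)"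
        using jm by (simp add: power_mult[symmetric] power_add[symmetric] mult.assoc[symmetric])
      also have "dist_nearest_int \<dots> \<le> real (b ^ (K * j - m)) * dist_nearest_int (real b ^ m * x)"
        by (rule dist_nearest_int_mult)
      also have "\<dots> \<le> real (b ^ K) * dist_nearest_int (real b ^ m * x)"
        using assms jm by (intro mult_right_mono dist_nearest_int_nonneg)
          (simp only: of_nat_le_iff, rule power_increasing, auto)
      finally have 1: "real b powr (- real (K * j) * (c - 1)) < real b powr real K * dist_nearest_int (real b ^ m * x)"
        using assms unfolding pw by (simp add: powr_realpow ac_simps)
      have "real K * c / (a - c) \<le> real m" using m unfolding m0_def by linarith
      then have mc: "real K * c \<le> real m * (a - c)" using c by (simp add: field_simps)
      have "real (K * j) \<le> real m + real K" using jm(2) by (metis of_nat_le_iff of_nat_add)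
      then have "real (K * j) * (c - 1) \<le> (real m + real K) * (c - 1)"
        using c1 by (intro mult_right_mono) auto
      then have "real K - real m * (a - 1) \<le> - real (K * j) * (c - 1)"
        using mc by (simp add: algebra_simps)
      then have "real b powr (real K - real m * (a - 1)) \<le> real b powr (- real (K * j) * (c - 1))"
        using assms by (intro powr_mono) auto
      with 1 have "real b powr (real K - real m * (a - 1)) < real b powr real K * dist_nearest_int (real b ^ m * x)"
        by linarith
      then have "real b powr real K * real b powr (- real m * (a - 1)) < real b powr real K * dist_nearest_int (real b ^ m * x)"
        by (simp flip: powr_add)
      then show ?thesis using assms by simp
    qed
    then show "\<forall>\<^sub>F n in sequentially. real b powr (- real n * (a - 1)) < dist_nearest_int (real b ^ n * x)"
      unfolding eventually_sequentially by blast
  qed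
qed

section \<open>Hoelder exponents of Levy functions\<close>

lemma abs_sawtooth_le: "\<bar>sawtooth x\<bar> \<le> 1/2"
proof -
  have "\<bar>x - of_int \<lfloor>x\<rfloor> - 1/2\<bar> \<le> 1/2" by linarith
  then show ?thesis by (simp add: sawtooth_def)
qed

lemma sawtooth_diff_le: "\<bar>sawtooth x - sawtooth y\<bar> \<le> 1"
  using abs_sawtooth_le[of x] abs_sawtooth_le[of y] by linarith

text \<open>Since \<open>u\<close> is nearer to \<open>v\<close> than to any integer, no integer
  lies between them or equals either, and the sawtooth has slope 1 there.\<close>

lemma sawtooth_diff_eq:
  assumes "\<And>k::int. \<bar>u - v\<bar> < \<bar>u - of_int k\<bar>"
  shows "sawtooth v - sawtooth u = v - u"
proof -
  have "u \<notin> \<int>"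
  proof
    assume "u \<in> \<int>"
    then obtain k where "u = of_int k" by (rule Ints_cases)
    then show False using assms[of k] by simp
  qed
  moreover have "v \<notin> \<int>"
  proof
    assume "v \<in> \<int>"
    then obtain k where "v = of_int k" by (rule Ints_cases)
    then show False using assms[of k] by simp
  qed
  moreover have "\<lfloor>u\<rfloor> = \<lfloor>v\<rfloor>"
  proof (rule ccontr)
    assume "\<lfloor>u\<rfloor> \<noteq> \<lfloor>v\<rfloor>"
    then consider "\<lfloor>u\<rfloor> < \<lfloor>v\<rfloor>" | "\<lfloor>v\<rfloor> < \<lfloor>u\<rfloor>" by linarith
    then show False
    proof cases
      case 1
      then have "u < of_int \<lfloor>v\<rfloor>" "of_int \<lfloor>v\<rfloor> \<le> v" by (simp_all add: floor_less_iff)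
      then show False using assms[of "\<lfloor>v\<rfloor>"] by linarith
    next
      case 2
      then have "v < of_int \<lfloor>u\<rfloor>" "of_int \<lfloor>u\<rfloor> \<le> u" by (simp_all add: floor_less_iff)
      then show False using assms[of "\<lfloor>u\<rfloor>"] by linarith
    qed
  qed
  ultimately show ?thesis by (simp add: sawtooth_def)
qed

text \<open>At an integer the left limit is 1/2 and the right limit is -1/2; elsewhere the function
  is continuous. The symmetric difference avoids the value 0 at the integer itself.\<close>

lemma sawtooth_jump:
  assumes "c > 0"
  shows "((\<lambda>h. sawtooth (c * (p - h)) - sawtooth (c * (p + h))) \<longlongrightarrow> of_bool (c * p \<in> \<int>)) (at_right 0)"
proof -
  define z where "z = c * p"
  \<comment> \<open>Moving from \<open>z\<close> by less than \<open>e\<close> to either side meets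
    no integer other than possibly \<open>z\<close> itself.\<close>
  define e where "e = (if z \<in> \<int> then 1 else min (frac z) (1 - frac z))"
  have e: "e > 0" unfolding e_def using frac_lt_1[of z] frac_gt_0_iff[of z] by auto
  have eq: "sawtooth (z - u) - sawtooth (z + u) = of_bool (z \<in> \<int>) - 2 * u" if u: "0 < u" "u < e" for u
  proof (cases "z \<in> \<int>")
    case True
    then obtain k :: int where k: "z = of_int k" by (auto elim: Ints_cases)
    have u1: "u < 1" using u True by (simp add: e_def)
    have f1: "\<lfloor>z - u\<rfloor> = k - 1" unfolding k using u u1 by (intro floor_unique) auto
    have f2: "\<lfloor>z + u\<rfloor> = k" unfolding k using u u1 by (intro floor_unique) auto
    have "frac (z - u) \<noteq> 0" "frac (z + u) \<noteq> 0"
      using u u1 f1 f2 k unfolding frac_def by simp_all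
    then have "z - u \<notin> \<int>" "z + u \<notin> \<int>" by (auto simp: frac_eq_0_iff)
    then show ?thesis using True f1 f2 k by (simp add: sawtooth_def)
  next
    case False
    then have u': "u < frac z" "u < 1 - frac z" using u by (auto simp: e_def)
    have f1: "\<lfloor>z - u\<rfloor> = \<lfloor>z\<rfloor>" using u u' unfolding frac_def by (intro floor_unique) linarith+
    have f2: "\<lfloor>z + u\<rfloor> = \<lfloor>z\<rfloor>" using u u' unfolding frac_def by (intro floor_unique) linarith+
    have "frac (z - u) \<noteq> 0" "frac (z + u) \<noteq> 0"
      using u u' f1 f2 unfolding frac_def by linarith+
    then have "z - u \<notin> \<int>" "z + u \<notin> \<int>" by (auto simp: frac_eq_0_iff)
    then show ?thesis using False f1 f2 by (simp add: sawtooth_def)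
  qed
  have "((\<lambda>h. of_bool (z \<in> \<int>) - 2 * (c * h)) \<longlongrightarrow> of_bool (z \<in> \<int>) - 2 * (c * 0)) (at_right 0)"
    by (intro tendsto_intros)
  moreover have "eventually (\<lambda>h. h \<in> {0<..<e / c}) (at_right 0)"
    using e assms by (intro eventually_at_right_real) auto
  then have "eventually (\<lambda>h. of_bool (z \<in> \<int>) - 2 * (c * h) = sawtooth (c * (p - h)) - sawtooth (c * (p + h))) (at_right 0)"
  proof eventually_elim
    case (elim h)
    then have "0 < c * h" "c * h < e" using assms by (auto simp: field_simps)
    from eq[OF this] show ?case by (simp add: z_def algebra_simps)
  qed
  ultimately show ?thesis by (simp add: z_def tendsto_cong)
qed

lemma powr_power_nat: "0 < x \<Longrightarrow> (x powr t) ^ n = x powr (t * real n)" for x :: real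
  by (simp add: powr_powr flip: powr_realpow)

lemma levy_term_eq:
  assumes "b \<ge> 2"
  shows "s / real b powr (\<alpha> * real (Suc i)) = s * (real b powr (- \<alpha>)) ^ Suc i"
proof -
  have "(real b powr (- \<alpha>)) ^ Suc i = real b powr (- (\<alpha> * real (Suc i)))"
    using assms by (subst powr_power_nat) auto
  then show ?thesis by (simp only: powr_minus divide_inverse)
qed

lemma powr_neg_lt_1: "b \<ge> 2 \<Longrightarrow> t < 0 \<Longrightarrow> real b powr t < 1"
  by (intro powr_less_one) auto

lemma levy_eq:
  assumes "b \<ge> 2"
  shows "levy b \<alpha> x = (\<Sum>i. sawtooth (real b ^ Suc i * x) * (real b powr (- \<alpha>)) ^ Suc i)"
  unfolding levy_def levy_term_eq[OF assms] ..

lemma summable_levy: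
  assumes "0 < q" "q < (1::real)"
  shows "summable (\<lambda>i. sawtooth (c i) * q ^ Suc i)"
proof (rule summable_comparison_test'[where N = 0])
  show "summable (\<lambda>i. q ^ Suc i)" using assms by (simp add: summable_Suc_iff summable_geometric)
  show "norm (sawtooth (c n) * q ^ Suc n) \<le> q ^ Suc n" for n
    using abs_sawtooth_le[of "c n"] assms mult_right_mono[of "\<bar>sawtooth (c n)\<bar>" 1 "q ^ Suc n"]
    by (simp add: abs_mult)
qed

lemma levy_diff_sums:
  assumes "b \<ge> 2" "\<alpha> > 0"
  shows "(\<lambda>i. (sawtooth (real b ^ Suc i * x) - sawtooth (real b ^ Suc i * y)) * (real b powr (- \<alpha>)) ^ Suc i)
     sums (levy b \<alpha> x - levy b \<alpha> y)"
  unfolding levy_eq[OF assms(1)] left_diff_distrib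
  using assms powr_neg_lt_1[of b "- \<alpha>"] by (intro sums_diff summable_sums summable_levy) auto

text \<open>The jumps of the single terms are all nonnegative, so the series jumps by at least as
  much as any one of them. Tannery's theorem with a geometric majorant exchanges limit and
  sum.\<close>

lemma levy_jump:
  assumes b: "b \<ge> 2" and \<alpha>: "\<alpha> > 0"
  obtains J where "J \<ge> (real b powr (- \<alpha>)) ^ Suc l"
    "((\<lambda>h. levy b \<alpha> (of_int k / real b ^ l - h) - levy b \<alpha> (of_int k / real b ^ l + h)) \<longlongrightarrow> J) (at_right 0)"
proof -
  define q where "q = real b powr (- \<alpha>)"
  have q: "0 < q" "q < 1" using b \<alpha> powr_neg_lt_1[of b "- \<alpha>"] by (auto simp: q_def)
  define p where "p = of_int k / real b ^ l"
  define T where "T = (\<lambda>i h. (sawtooth (real b ^ Suc i * (p - h)) - sawtooth (real b ^ Suc i * (p + h))) * q ^ Suc i)"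
  define B where "B = (\<lambda>i. of_bool (real b ^ Suc i * p \<in> \<int>) * q ^ Suc i)"
  have sq: "summable (\<lambda>i. q ^ Suc i)" using q by (simp add: summable_Suc_iff summable_geometric)
  have "eventually (\<lambda>h. summable (\<lambda>k. norm (T k h))) (at_right 0) \<and>
           summable (\<lambda>n. norm (B n)) \<and>
           ((\<lambda>h. suminf (\<lambda>k. T k h)) \<longlongrightarrow> suminf B) (at_right 0)"
  proof (rule tannerys_theorem[where M = "\<lambda>i. q ^ Suc i"])
    show "(T i \<longlongrightarrow> B i) (at_right 0)" for i
      unfolding T_def B_def using b by (intro tendsto_mult sawtooth_jump tendsto_const) auto
    have "norm (T i h) \<le> q ^ Suc i" for i h
      using sawtooth_diff_le[of "real b ^ Suc i * (p - h)" "real b ^ Suc i * (p + h)"] q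
        mult_right_mono[of _ 1 "q ^ Suc i"]
      unfolding T_def by (simp add: abs_mult)
    then show "\<forall>\<^sub>F (i, h) in sequentially \<times>\<^sub>F at_right 0. norm (T i h) \<le> q ^ Suc i"
      by (intro always_eventually) auto
  qed (use sq in auto)
  moreover have "suminf (\<lambda>i. T i h) = levy b \<alpha> (p - h) - levy b \<alpha> (p + h)" for h
    using levy_diff_sums[OF b \<alpha>, of "p - h" "p + h"] by (simp add: T_def q_def sums_iff)
  ultimately have lim: "((\<lambda>h. levy b \<alpha> (p - h) - levy b \<alpha> (p + h)) \<longlongrightarrow> suminf B) (at_right 0)"
    and sB: "summable B" by (auto intro: summable_norm_cancel)
  \<comment> \<open>The term of exponent \<open>Suc l\<close> jumps at \<open>p\<close> for every
    \<open>l\<close>, including \<open>l = 0\<close>, where the series has no term of exponent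
    \<open>l\<close>. The loss is a constant factor.\<close>
  have "real b ^ Suc l * p = of_int (int b * k)" using b by (simp add: p_def)
  then have "real b ^ Suc l * p \<in> \<int>" by (metis Ints_of_int)
  then have "q ^ Suc l = sum B {l}" by (simp add: B_def)
  also have "\<dots> \<le> suminf B" using sB q by (intro sum_le_suminf) (auto simp: B_def)
  finally show thesis using lim that unfolding p_def q_def by blast
qed

text \<open>A point \<open>p = k / b ^ n\<close> within \<open>b powr (- n a)\<close> of
  \<open>x0\<close> carries a jump of at least \<open>b powr (- \<alpha> (n + 1))\<close>.
  Polynomials are continuous, so the Hoelder bound allows at most
  \<open>2 C b powr (- n a \<beta>)\<close>. Infinitely many such \<open>n\<close> force
  \<open>\<beta> * a \<le> \<alpha>\<close>.\<close>

lemma pointwise_holder_levy_imp: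
  assumes b: "b \<ge> 2" and \<alpha>: "\<alpha> > 0" and \<beta>: "\<beta> > 0" and a: "a > 0" "ereal a < approx_exponent b x0"
    and hol: "pointwise_holder (levy b \<alpha>) \<beta> x0"
  shows "\<beta> * a \<le> \<alpha>"
proof (rule ccontr)
  assume "\<not> \<beta> * a \<le> \<alpha>"
  define f where "f = levy b \<alpha>"
  from hol obtain C r P where C: "C > 0" and r: "r > 0"
    and P: "\<And>x. x \<in> {x0 - r..x0 + r} \<Longrightarrow> \<bar>f x - poly P (x - x0)\<bar> \<le> C * \<bar>x - x0\<bar> powr \<beta>"
    unfolding pointwise_holder_def f_def by blast
  have b1: "real b > 1" using b by simp
  have key: "(real b powr (- \<alpha>)) ^ Suc n \<le> 2 * C * real b powr (- real n * a * \<beta>)"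
    if n: "dist_nearest_int (real b ^ n * x0) \<le> real b powr (- real n * (a - 1))"
      "real b powr (- real n * a) < r" for n
  proof -
    define k where "k = round (real b ^ n * x0)"
    define p where "p = of_int k / real b ^ n"
    obtain J where J: "(real b powr (- \<alpha>)) ^ Suc n \<le> J"
      "((\<lambda>h. f (p - h) - f (p + h)) \<longlongrightarrow> J) (at_right 0)"
      using levy_jump[OF b \<alpha>, of n k] unfolding p_def f_def by metis
    have "real b ^ n * \<bar>p - x0\<bar> = \<bar>real b ^ n * (p - x0)\<bar>" using b1 by (simp add: abs_mult)
    also have "real b ^ n * (p - x0) = of_int k - real b ^ n * x0"
      using b1 by (simp add: p_def field_simps)
    also have "\<bar>of_int k - real b ^ n * x0\<bar> \<le> real b powr (- real n * (a - 1))"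
      using n(1) by (simp add: dist_nearest_int_eq k_def abs_minus_commute)
    also have "\<dots> = real b ^ n * real b powr (- real n * a)"
      using b1 by (simp add: algebra_simps flip: powr_realpow powr_add)
    finally have px: "\<bar>p - x0\<bar> \<le> real b powr (- real n * a)"
      using b1 by (simp add: mult_le_cancel_left_pos)
    \<comment> \<open>\<open>R h\<close> bounds the difference of \<open>f\<close> across
      \<open>p\<close>. Its polynomial part vanishes in the limit, and the two error terms tend to
      the same value.\<close>
    define R where "R = (\<lambda>h. C * \<bar>p - h - x0\<bar> powr \<beta> + C * \<bar>p + h - x0\<bar> powr \<beta>
        + \<bar>poly P (p - h - x0) - poly P (p + h - x0)\<bar>)"
    have "(R \<longlongrightarrow> C * \<bar>p - 0 - x0\<bar> powr \<beta> + C * \<bar>p + 0 - x0\<bar> powr \<beta>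
        + \<bar>poly P (p - 0 - x0) - poly P (p + 0 - x0)\<bar>) (at_right 0)"
      unfolding R_def using \<beta> by (intro tendsto_intros tendsto_powr') auto
    then have "(R \<longlongrightarrow> 2 * C * \<bar>p - x0\<bar> powr \<beta>) (at_right 0)" by (simp add: mult.assoc)
    moreover have "eventually (\<lambda>h. f (p - h) - f (p + h) \<le> R h) (at_right 0)"
    proof -
      have "eventually (\<lambda>h. h \<in> {0<..<r - \<bar>p - x0\<bar>}) (at_right 0)"
        using px n(2) by (intro eventually_at_right_real) auto
      then show ?thesis
      proof eventually_elim
        case (elim h)
        then have "p - h \<in> {x0 - r..x0 + r}" "p + h \<in> {x0 - r..x0 + r}" by auto
        from P[OF this(1)] P[OF this(2)] show ?case unfolding R_def by linarith
      qed
    qed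
    ultimately have "J \<le> 2 * C * \<bar>p - x0\<bar> powr \<beta>"
      by (intro tendsto_le[OF _ _ J(2)]) auto
    also have "\<dots> \<le> 2 * C * (real b powr (- real n * a)) powr \<beta>"
      using C px \<beta> by (intro mult_left_mono powr_mono2) auto
    finally show ?thesis using J(1) by (simp add: powr_powr)
  qed
  \<comment> \<open>Multiplied by \<open>b powr (\<alpha> + n a \<beta>)\<close>, the inequality
    \<open>key\<close> reads \<open>g ^ n \<le> 2 C b powr \<alpha>\<close>, which fails for large
    \<open>n\<close> because \<open>g > 1\<close>.\<close>
  define g where "g = real b powr (\<beta> * a - \<alpha>)"
  have "g > 1" unfolding g_def using b1 \<open>\<not> \<beta> * a \<le> \<alpha>\<close> by (intro gr_one_powr) auto
  obtain N where "2 * C * real b powr \<alpha> < g ^ N"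
    using real_arch_pow[OF \<open>g > 1\<close>] by blast
  then have "\<forall>\<^sub>F n in sequentially. 2 * C * real b powr \<alpha> < g ^ n"
    unfolding eventually_sequentially using \<open>g > 1\<close>
    by (meson less_imp_le less_le_trans power_increasing)
  moreover have "(\<lambda>n. (real b powr (- a)) ^ n) \<longlonglongrightarrow> 0"
    using b a by (intro LIMSEQ_realpow_zero) (auto simp: powr_neg_lt_1)
  then have "\<forall>\<^sub>F n in sequentially. (real b powr (- a)) ^ n < r"
    using r by (rule order_tendstoD)
  ultimately have ev: "\<forall>\<^sub>F n in sequentially. 2 * C * real b powr \<alpha> < g ^ n \<and> (real b powr (- a)) ^ n < r"
    by (rule eventually_conj)
  have "\<exists>\<^sub>\<infinity>n. dist_nearest_int (real b ^ n * x0) \<le> real b powr (- real n * (a - 1))"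
    using approx_exponent_gtD[OF b a(2)] by (simp add: INFM_iff_infinite)
  from INFM_conjI[OF this ev[folded cofinite_eq_sequentially]]
  obtain n where n: "dist_nearest_int (real b ^ n * x0) \<le> real b powr (- real n * (a - 1))"
    "2 * C * real b powr \<alpha> < g ^ n" "(real b powr (- a)) ^ n < r"
    by (blast dest: INFM_EX)
  have "(real b powr (- \<alpha>)) ^ Suc n \<le> 2 * C * real b powr (- real n * a * \<beta>)"
    using n b1 by (intro key) (simp_all add: powr_powr mult.commute flip: powr_realpow)
  then have "real b powr (\<alpha> + real n * a * \<beta>) * (real b powr (- \<alpha>)) ^ Suc n \<le>
      real b powr (\<alpha> + real n * a * \<beta>) * (2 * C * real b powr (- real n * a * \<beta>))"
    by (rule mult_left_mono) auto
  also have "\<dots> = 2 * C * real b powr \<alpha>"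
    by (simp add: mult_ac flip: powr_add)
  also have "real b powr (\<alpha> + real n * a * \<beta>) * (real b powr (- \<alpha>)) ^ Suc n = g ^ n"
    using b1 unfolding g_def by (simp add: powr_powr algebra_simps flip: powr_realpow powr_add del: power_Suc)
  finally show False using n(2) by linarith
qed

section \<open>Affine partial sums and the lower bound for the Hoelder exponent\<close>

text \<open>An integer close to \<open>b ^ i * x0\<close>, multiplied by \<open>b ^ (n - i)\<close>,
  is an integer close to \<open>b ^ n * x0\<close>. Hence the hypothesis at level \<open>n\<close>
  controls all earlier levels.\<close>

lemma sawtooth_power_diff_eq:
  assumes b: "b \<ge> 2" and i: "i \<le> n" and t: "real b ^ n * \<bar>x - x0\<bar> < dist_nearest_int (real b ^ n * x0)"
  shows "sawtooth (real b ^ i * x) - sawtooth (real b ^ i * x0) = real b ^ i * (x - x0)"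
proof -
  have b0: "real b > 0" using b by simp
  have "sawtooth (real b ^ i * x) - sawtooth (real b ^ i * x0) = real b ^ i * x - real b ^ i * x0"
  proof (rule sawtooth_diff_eq, rule ccontr)
    fix k :: int
    assume "\<not> \<bar>real b ^ i * x0 - real b ^ i * x\<bar> < \<bar>real b ^ i * x0 - of_int k\<bar>"
    then have "dist_nearest_int (real b ^ i * x0) \<le> \<bar>real b ^ i * x0 - real b ^ i * x\<bar>"
      using dist_nearest_int_le[of "real b ^ i * x0" k] by linarith
    also have "real b ^ i * x0 - real b ^ i * x = - (real b ^ i * (x - x0))" by (simp add: algebra_simps)
    also have "\<bar>- (real b ^ i * (x - x0))\<bar> = real b ^ i * \<bar>x - x0\<bar>" by (simp add: abs_mult)
    finally have "real (b ^ (n - i)) * dist_nearest_int (real b ^ i * x0) \<le> real (b ^ (n - i)) * (real b ^ i * \<bar>x - x0\<bar>)"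
      by (intro mult_left_mono) auto
    also have "\<dots> = real b ^ n * \<bar>x - x0\<bar>"
      using i by (simp flip: power_add mult.assoc)
    finally have "dist_nearest_int (real (b ^ (n - i)) * (real b ^ i * x0)) \<le> real b ^ n * \<bar>x - x0\<bar>"
      using dist_nearest_int_mult order_trans by blast
    also have "real (b ^ (n - i)) * (real b ^ i * x0) = real b ^ n * x0"
      using i by (simp flip: power_add mult.assoc)
    finally show False using t by simp
  qed
  then show ?thesis by (simp add: algebra_simps)
qed

lemma sum_power_Suc_le:
  assumes "0 < r" "r < (1::real)"
  shows "(\<Sum>i<n. r ^ Suc i) \<le> 1 / (1 - r)"
proof -
  have "(\<Sum>i<n. r ^ Suc i) = r * (\<Sum>i<n. r ^ i)" by (simp add: sum_distrib_left)
  also have "\<dots> \<le> 1 * (\<Sum>i<n. r ^ i)" using assms by (intro mult_right_mono sum_nonneg) auto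
  also have "(\<Sum>i<n. r ^ i) = (1 - r ^ n) / (1 - r)" using assms by (simp add: sum_gp_strict)
  also have "1 * \<dots> \<le> 1 / (1 - r)" using assms by (simp add: divide_right_mono)
  finally show ?thesis .
qed

text \<open>The hypothesis says that no jump of generation at most \<open>n\<close> separates \<open>x\<close> from \<open>x0\<close>, so the
  first \<open>n\<close> terms of the series are affine between the two points.\<close>
lemma levy_increment:
  fixes b :: nat and \<alpha> x x0 :: real and n :: nat
  assumes b: "b \<ge> 2" and \<alpha>: "\<alpha> > 0"
    and t: "real b ^ n * \<bar>x - x0\<bar> < dist_nearest_int (real b ^ n * x0)"
  defines "q \<equiv> real b powr (- \<alpha>)"
  shows "\<bar>levy b \<alpha> x - levy b \<alpha> x0 - (\<Sum>i<n. (real b powr (1 - \<alpha>)) ^ Suc i) * (x - x0)\<bar> \<le> q ^ Suc n / (1 - q)"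
proof -
  have q: "0 < q" "q < 1" using b \<alpha> powr_neg_lt_1[of b "- \<alpha>"] by (auto simp: q_def)
  have b0: "real b > 0" using b by simp
  define T where "T = (\<lambda>i. (sawtooth (real b ^ Suc i * x) - sawtooth (real b ^ Suc i * x0)) * q ^ Suc i)"
  have T: "T sums (levy b \<alpha> x - levy b \<alpha> x0)"
    unfolding T_def q_def by (rule levy_diff_sums[OF b \<alpha>])
  have "(\<Sum>i<n. T i) = (\<Sum>i<n. (real b powr (1 - \<alpha>)) ^ Suc i * (x - x0))"
  proof (intro sum.cong refl)
    fix i assume "i \<in> {..<n}"
    then have "T i = (real b ^ Suc i * q ^ Suc i) * (x - x0)"
      using sawtooth_power_diff_eq[OF b _ t, of "Suc i"] by (simp add: T_def)
    also have "real b ^ Suc i * q ^ Suc i = (real b powr (1 - \<alpha>)) ^ Suc i"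
      unfolding q_def power_mult_distrib[symmetric] using b0 by (simp add: powr_diff powr_minus_divide)
    finally show "T i = (real b powr (1 - \<alpha>)) ^ Suc i * (x - x0)" .
  qed
  then have "(\<lambda>i. T (i + n)) sums (levy b \<alpha> x - levy b \<alpha> x0 - (\<Sum>i<n. (real b powr (1 - \<alpha>)) ^ Suc i) * (x - x0))"
    using sums_split_initial_segment[OF T, of n] by (simp add: sum_distrib_right)
  moreover have "(\<lambda>i. q ^ Suc n * q ^ i) sums (q ^ Suc n * (1 / (1 - q)))"
    using q by (intro sums_mult geometric_sums) auto
  moreover have "\<bar>T (i + n)\<bar> \<le> q ^ Suc n * q ^ i" for i
  proof -
    have "\<bar>T (i + n)\<bar> \<le> 1 * q ^ Suc (i + n)"
      unfolding T_def abs_mult using q by (intro mult_mono sawtooth_diff_le) auto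
    then show ?thesis by (simp add: power_add mult_ac)
  qed
  ultimately show ?thesis
    by (metis (no_types, lifting) norm_suminf_le real_norm_def sums_iff times_divide_eq_right mult.right_neutral)
qed

text \<open>For \<open>b powr (- (n + 1) D) \<le> \<bar>x - x0\<bar> < b powr (- n D)\<close> the
  first \<open>n\<close> terms are affine, and the tail is of order
  \<open>b powr (- \<alpha> (n + 1))\<close>, hence at most of order
  \<open>\<bar>x - x0\<bar> powr \<beta>\<close>. The affine part is itself of this order if
  \<open>\<beta> \<le> 1\<close>; otherwise its slopes converge and the limit goes into
  \<open>P\<close>.\<close>

lemma pointwise_holder_levy:
  assumes b: "b \<ge> 2" and \<alpha>: "\<alpha> > 0" and D: "approx_exponent b x0 < ereal D" and \<beta>: "\<beta> > 0" "\<beta> * D < \<alpha>"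
  shows "pointwise_holder (levy b \<alpha>) \<beta> x0"
proof -
  define f where "f = levy b \<alpha>"
  define q where "q = real b powr (- \<alpha>)"
  define \<rho> where "\<rho> = real b powr (1 - \<alpha>)"
  have b1: "real b > 1" using b by simp
  have q: "0 < q" "q < 1" using b \<alpha> powr_neg_lt_1[of b "- \<alpha>"] by (auto simp: q_def)
  have "1 < ereal D" using approx_exponent_ge_1[OF b, of x0] D by (rule le_less_trans)
  then have D1: "D > 1" by (simp add: one_ereal_def)
  obtain N where N: "\<And>n. n \<ge> N \<Longrightarrow> real b powr (- real n * (D - 1)) < dist_nearest_int (real b ^ n * x0)"
    using approx_exponent_lessD[OF b D] unfolding eventually_sequentially by auto
  \<comment> \<open>For \<open>\<beta> > 1\<close> one has
    \<open>\<alpha> > \<beta> * D > 1\<close>, so \<open>\<rho> < 1\<close>, and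
    \<open>\<rho> / (1 - \<rho>)\<close> is the sum of the slopes of all terms.\<close>
  define P where "P = (if \<beta> \<le> 1 then [:f x0:] else [:f x0, \<rho> / (1 - \<rho>):])"
  \<comment> \<open>This is the ratio left when \<open>t powr \<beta>\<close> is split off from
    \<open>\<rho> ^ i * t\<close> and the remaining \<open>t powr (1 - \<beta>)\<close> is bounded
    by \<open>b powr (- i D (1 - \<beta>))\<close>. Its exponent is
    \<open>(1 - D) + (\<beta> * D - \<alpha>) < 0\<close>.\<close>
  define \<sigma> where "\<sigma> = real b powr (1 - \<alpha> - D * (1 - \<beta>))"
  define C where "C = 1 / (1 - q) + (if \<beta> \<le> 1 then 1 / (1 - \<sigma>) else real b / (1 - \<rho>))"
  define r where "r = real b powr (- real N * D) / 2"
  have r: "r > 0" using b1 by (simp add: r_def)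
  have \<sigma>: "0 < \<sigma>" "\<sigma> < 1"
    using b D1 \<beta> unfolding \<sigma>_def by (auto intro!: powr_neg_lt_1 simp: algebra_simps)
  have \<rho>: "0 < \<rho>" "\<rho> < 1" if "\<beta> > 1"
  proof -
    have "1 * 1 < \<beta> * D" using that D1 by (intro mult_strict_mono) auto
    then have "\<alpha> > 1" using \<beta> by simp
    then show "0 < \<rho>" "\<rho> < 1" using b by (auto simp: \<rho>_def intro!: powr_neg_lt_1)
  qed
  have C: "C > 0"
    using q \<sigma> \<rho> b1 unfolding C_def by (auto intro!: add_pos_pos divide_pos_pos)
  have main: "\<bar>f x - poly P (x - x0)\<bar> \<le> C * \<bar>x - x0\<bar> powr \<beta>" if x: "x \<in> {x0 - r..x0 + r}" for x
  proof (cases "x = x0")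
    case True then show ?thesis by (simp add: P_def)
  next
    case False
    define t where "t = \<bar>x - x0\<bar>"
    have t: "t > 0" using False by (simp add: t_def)
    have tr: "t < real b powr (- real N * D)" 
    proof -
      have "t \<le> r" using x unfolding t_def by auto
      moreover have "r < real b powr (- real N * D)" using r unfolding r_def by linarith
      ultimately show ?thesis by linarith
    qed
    have "(\<lambda>n. (real b powr (- D)) ^ n) \<longlonglongrightarrow> 0"
      using b D1 by (intro LIMSEQ_realpow_zero) (auto simp: powr_neg_lt_1)
    from order_tendstoD(2)[OF this t] have "\<exists>m. (real b powr (- D)) ^ m < t"
      by (auto simp: eventually_sequentially)
    then have ex: "\<exists>m. real b powr (- real m * D) \<le> t"
      using b1 by (auto simp: powr_power_nat mult.commute intro: less_imp_le)
    \<comment> \<open>Minimality of \<open>m\<close> gives both bounds on \<open>t\<close>, with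
      \<open>n = m - 1\<close>; the choice of \<open>r\<close> makes \<open>m > N\<close>, so that
      the lower bound on the distance holds at level \<open>n\<close>.\<close>
    define m where "m = (LEAST m. real b powr (- real m * D) \<le> t)"
    have m: "real b powr (- real m * D) \<le> t" unfolding m_def using ex by (rule LeastI_ex)
    have mN: "m > N"
    proof (rule ccontr)
      assume "\<not> m > N"
      then have "real m * D \<le> real N * D" using D1 by (intro mult_right_mono) auto
      then have "real b powr (- real N * D) \<le> real b powr (- real m * D)"
        using b1 by (intro powr_mono) auto
      then show False using m tr by linarith
    qed
    define n where "n = m - 1"
    have mS: "m = Suc n" and nN: "n \<ge> N" using mN by (auto simp: n_def)
    have tn: "t < real b powr (- real n * D)"
      using not_less_Least[of n "\<lambda>m. real b powr (- real m * D) \<le> t"] mS unfolding m_def by simp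
    have "real b ^ n * t < real b ^ n * real b powr (- real n * D)" using tn b1 by simp
    also have "\<dots> = real b powr (- real n * (D - 1))"
      using b1 by (simp add: algebra_simps flip: powr_realpow powr_add)
    also have "\<dots> < dist_nearest_int (real b ^ n * x0)" using N nN by blast
    finally have incr: "\<bar>f x - f x0 - (\<Sum>i<n. \<rho> ^ Suc i) * (x - x0)\<bar> \<le> q ^ Suc n / (1 - q)"
      unfolding t_def f_def \<rho>_def q_def by (rule levy_increment[OF b \<alpha>])
    have "q ^ Suc n = real b powr (- \<alpha> * real m)" using b1 by (simp add: q_def powr_power_nat mS del: power_Suc)
    also have "\<dots> \<le> real b powr (- real m * D * \<beta>)"
      using b1 \<beta> mult_right_mono[of "\<beta> * D" \<alpha> "real m"] by (intro powr_mono) (auto simp: algebra_simps)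
    also have "\<dots> = (real b powr (- real m * D)) powr \<beta>" by (simp add: powr_powr)
    also have "\<dots> \<le> t powr \<beta>" using m \<beta> by (intro powr_mono2) auto
    finally have qt: "q ^ Suc n \<le> t powr \<beta>" .
    then have tail: "q ^ Suc n / (1 - q) \<le> 1 / (1 - q) * t powr \<beta>"
      using q by (simp add: divide_right_mono)
    show ?thesis
    proof (cases "\<beta> \<le> 1")
      case True
      have "\<rho> ^ Suc i * t \<le> t powr \<beta> * \<sigma> ^ Suc i" if "i < n" for i
      proof -
        have "t = t powr \<beta> * t powr (1 - \<beta>)" using t by (simp flip: powr_add)
        also have "\<dots> \<le> t powr \<beta> * (real b powr (- real n * D)) powr (1 - \<beta>)"
          using True tn t by (intro mult_left_mono powr_mono2) auto
        also have "(real b powr (- real n * D)) powr (1 - \<beta>) = real b powr (- (real n * (D * (1 - \<beta>))))"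
          by (simp add: powr_powr mult.assoc)
        also have "t powr \<beta> * real b powr (- (real n * (D * (1 - \<beta>)))) \<le> t powr \<beta> * real b powr (- (real (Suc i) * (D * (1 - \<beta>))))"
          using that True D1 b1 by (intro mult_left_mono powr_mono) (auto intro!: mult_right_mono)
        finally have "\<rho> ^ Suc i * t \<le> \<rho> ^ Suc i * (t powr \<beta> * real b powr (- (real (Suc i) * (D * (1 - \<beta>)))))"
          using b1 by (intro mult_left_mono) (auto simp: \<rho>_def)
        also have "\<dots> = t powr \<beta> * (real b powr ((1 - \<alpha>) * real (Suc i)) * real b powr (- (real (Suc i) * (D * (1 - \<beta>)))))"
          using b1 by (simp add: \<rho>_def powr_power_nat del: power_Suc of_nat_Suc)
        also have "\<dots> = t powr \<beta> * real b powr ((1 - \<alpha> - D * (1 - \<beta>)) * real (Suc i))"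
          unfolding powr_add[symmetric] by (simp only: left_diff_distrib) (simp add: mult_ac)
        also have "\<dots> = t powr \<beta> * \<sigma> ^ Suc i"
          using b1 by (simp add: \<sigma>_def powr_power_nat del: power_Suc of_nat_Suc)
        finally show ?thesis .
      qed
      then have "(\<Sum>i<n. \<rho> ^ Suc i) * t \<le> t powr \<beta> * (\<Sum>i<n. \<sigma> ^ Suc i)"
        unfolding sum_distrib_left sum_distrib_right by (intro sum_mono) auto
      also have "\<dots> \<le> t powr \<beta> * (1 / (1 - \<sigma>))"
        using sum_power_Suc_le[OF \<sigma>] by (intro mult_left_mono) auto
      finally have "\<bar>(\<Sum>i<n. \<rho> ^ Suc i) * (x - x0)\<bar> \<le> 1 / (1 - \<sigma>) * t powr \<beta>"
        unfolding abs_mult t_def[symmetric] by (subst abs_of_nonneg) (auto simp: \<rho>_def intro!: sum_nonneg)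
      moreover have "C * t powr \<beta> = 1 / (1 - q) * t powr \<beta> + 1 / (1 - \<sigma>) * t powr \<beta>"
        using True by (simp add: C_def distrib_right)
      moreover have "poly P (x - x0) = f x0" using True by (simp add: P_def)
      ultimately show ?thesis using incr tail unfolding t_def[symmetric] by linarith
    next
      case False
      then have \<rho>: "0 < \<rho>" "\<rho> < 1" using \<rho> by auto
      have "(\<Sum>i<n. \<rho> ^ Suc i) = \<rho> * (\<Sum>i<n. \<rho> ^ i)" by (simp add: sum_distrib_left)
      also have "\<dots> = \<rho> / (1 - \<rho>) - \<rho> ^ Suc n / (1 - \<rho>)"
        using \<rho> by (simp add: sum_gp_strict diff_divide_distrib[symmetric] algebra_simps)
      finally have S: "(\<Sum>i<n. \<rho> ^ Suc i) * (x - x0) = \<rho> / (1 - \<rho>) * (x - x0) - \<rho> ^ Suc n / (1 - \<rho>) * (x - x0)"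
        by (simp add: left_diff_distrib)
      \<comment> \<open>Replacing the partial sum of slopes by its limit costs
        \<open>t * \<rho> ^ Suc n / (1 - \<rho>)\<close>. As \<open>D > 1\<close>, \<open>t\<close>
        is at most \<open>b powr (- n)\<close>, so this cost is again of order
        \<open>q ^ Suc n\<close>.\<close>
      have "t * \<rho> ^ Suc n \<le> real b powr (- real n) * \<rho> ^ Suc n"
      proof (intro mult_right_mono)
        have "real b powr (- real n * D) \<le> real b powr (- real n)"
          using b1 D1 mult_left_mono[of 1 D "real n"] by (intro powr_mono) auto
        with tn show "t \<le> real b powr (- real n)" by linarith
      qed (use \<rho> in auto)
      also have "\<dots> = real b * q ^ Suc n"
      proof -
        have "\<rho> ^ Suc n = real b ^ Suc n * q ^ Suc n"
          unfolding q_def \<rho>_def power_mult_distrib[symmetric] using b1 by (simp add: powr_diff powr_minus_divide)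
        then show ?thesis using b1 by (simp add: powr_minus powr_realpow)
      qed
      also have "\<dots> \<le> real b * t powr \<beta>" using qt b1 by simp
      finally have "t * \<rho> ^ Suc n / (1 - \<rho>) \<le> real b * t powr \<beta> / (1 - \<rho>)"
        using \<rho> by (intro divide_right_mono) auto
      then have "\<bar>\<rho> ^ Suc n / (1 - \<rho>) * (x - x0)\<bar> \<le> real b / (1 - \<rho>) * t powr \<beta>"
        using \<rho> by (simp add: abs_mult t_def mult_ac)
      moreover have "C * t powr \<beta> = 1 / (1 - q) * t powr \<beta> + real b / (1 - \<rho>) * t powr \<beta>"
        using False by (simp add: C_def distrib_right)
      moreover have "poly P (x - x0) = f x0 + \<rho> / (1 - \<rho>) * (x - x0)"
        using False by (simp add: P_def)
      ultimately show ?thesis using incr tail S unfolding t_def[symmetric] by linarith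
    qed
  qed
  have "real (degree P) < \<beta>" using \<beta> by (auto simp: P_def)
  with C r main show ?thesis unfolding pointwise_holder_def f_def by blast
qed

section \<open>Exact Hoelder exponents of the Levy function and its translate\<close>

lemma approx_exponent_cases:
  assumes "b \<ge> 2"
  obtains D where "approx_exponent b x = ereal D" "D \<ge> 1" | "approx_exponent b x = \<infinity>"
  using approx_exponent_ge_1[OF assms, of x] by (cases "approx_exponent b x") (auto simp: one_ereal_def)

text \<open>Let \<open>a\<close> tend to the approximation exponent from below in
  \<open>pointwise_holder_levy_imp\<close>, and \<open>D\<close> from above in
  \<open>pointwise_holder_levy\<close>. If the approximation exponent is infinite, no positive order
  occurs and the inserted 0 is the value.\<close>

theorem holder_exponent_levy:
  assumes b: "b \<ge> 2" and \<alpha>: "\<alpha> > 0"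
  shows "holder_exponent (levy b \<alpha>) x = ereal \<alpha> / approx_exponent b x"
  unfolding holder_exponent_def
proof (rule antisym)
  show "Sup (insert 0 (ereal ` {\<beta>. \<beta> > 0 \<and> pointwise_holder (levy b \<alpha>) \<beta> x})) \<le> ereal \<alpha> / approx_exponent b x"
  proof (rule Sup_least, safe)
    show "0 \<le> ereal \<alpha> / approx_exponent b x"
      using \<alpha> by (rule_tac approx_exponent_cases[OF b, of x]) auto
    fix \<beta> :: real assume \<beta>: "\<beta> > 0" "pointwise_holder (levy b \<alpha>) \<beta> x"
    have imp: "\<beta> * a \<le> \<alpha>" if "a > 0" "ereal a < approx_exponent b x" for a
      using pointwise_holder_levy_imp[OF b \<alpha> \<beta>(1) that \<beta>(2)] .
    show "ereal \<beta> \<le> ereal \<alpha> / approx_exponent b x"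
    proof (rule approx_exponent_cases[OF b, of x])
      fix D assume real: "approx_exponent b x = ereal D" "D \<ge> 1"
      have "\<beta> * D \<le> \<alpha>"
      proof (rule ccontr)
        assume "\<not> \<beta> * D \<le> \<alpha>"
        then have "\<alpha> / \<beta> < D" using \<beta> by (simp add: field_simps)
        then obtain a where "\<alpha> / \<beta> < a" "a < D" using dense by blast
        moreover from this have "a > 0" using \<alpha> \<beta> by (meson divide_pos_pos less_trans)
        ultimately show False using imp[of a] real \<beta> by (simp add: field_simps)
      qed
      then show ?thesis using real by (simp add: field_simps)
    next
      assume infinity: "approx_exponent b x = \<infinity>"
      \<comment> \<open>Every \<open>a\<close> lies below infinity; this one gives
        \<open>\<beta> * a = \<alpha> + \<beta>\<close>, a contradiction.\<close>
      have "\<beta> * (\<alpha> / \<beta> + 1) \<le> \<alpha>" using infinity \<alpha> \<beta> by (intro imp) (auto intro: add_pos_pos)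
      then show ?thesis using \<beta> by (simp add: algebra_simps)
    qed
  qed
  define S where "S = Sup (insert 0 (ereal ` {\<beta>. \<beta> > 0 \<and> pointwise_holder (levy b \<alpha>) \<beta> x}))"
  have "0 \<le> S" unfolding S_def by (rule Sup_upper) simp
  have "ereal \<alpha> / approx_exponent b x \<le> S"
  proof (rule approx_exponent_cases[OF b, of x])
    assume infinity: "approx_exponent b x = \<infinity>"
    then show ?thesis using \<open>0 \<le> S\<close> by simp
  next
    fix D assume real: "approx_exponent b x = ereal D" "D \<ge> 1"
    have "ereal (\<alpha> / D) \<le> S"
    proof (rule ccontr)
      assume "\<not> ?thesis"
      then obtain \<beta> where \<beta>: "S < ereal \<beta>" "\<beta> < \<alpha> / D"
        using ereal_dense2[of S "ereal (\<alpha> / D)"] by (auto simp: not_le)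
      have "0 < ereal \<beta>" using \<open>0 \<le> S\<close> \<beta>(1) by (rule le_less_trans)
      then have \<beta>0: "\<beta> > 0" by simp
      then have "D < \<alpha> / \<beta>" using \<beta>(2) real by (simp add: field_simps)
      then obtain D' where D': "D < D'" "D' < \<alpha> / \<beta>" using dense by blast
      have "pointwise_holder (levy b \<alpha>) \<beta> x"
        using D' \<beta>0 real by (intro pointwise_holder_levy[OF b \<alpha>, where D = D']) (auto simp: field_simps)
      then have "ereal \<beta> \<le> S"
        unfolding S_def using \<beta>0 by (intro Sup_upper) auto
      then show False using \<beta>(1) by simp
    qed
    then show ?thesis using real by simp
  qed
  then show "ereal \<alpha> / approx_exponent b x \<le> Sup (insert 0 (ereal ` {\<beta>. \<beta> > 0 \<and> pointwise_holder (levy b \<alpha>) \<beta> x}))"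
    unfolding S_def .
qed

lemma pointwise_holder_translate: "pointwise_holder (\<lambda>x. f (x - y)) \<beta> x0 = pointwise_holder f \<beta> (x0 - y)"
proof -
  have "(\<forall>x\<in>{x0 - r..x0 + r}. \<bar>f (x - y) - poly P (x - x0)\<bar> \<le> C * \<bar>x - x0\<bar> powr \<beta>)
      = (\<forall>x\<in>{x0 - y - r..x0 - y + r}. \<bar>f x - poly P (x - (x0 - y))\<bar> \<le> C * \<bar>x - (x0 - y)\<bar> powr \<beta>)"
    (is "?L = ?R") for P C r
  proof
    assume L: ?L
    show ?R
    proof
      fix x assume "x \<in> {x0 - y - r..x0 - y + r}"
      then show "\<bar>f x - poly P (x - (x0 - y))\<bar> \<le> C * \<bar>x - (x0 - y)\<bar> powr \<beta>"
        using L[rule_format, of "x + y"] by (simp add: algebra_simps)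
    qed
  next
    assume R: ?R
    show ?L
    proof
      fix x assume "x \<in> {x0 - r..x0 + r}"
      then show "\<bar>f (x - y) - poly P (x - x0)\<bar> \<le> C * \<bar>x - x0\<bar> powr \<beta>"
        using R[rule_format, of "x - y"] by (simp add: algebra_simps)
    qed
  qed
  then show ?thesis unfolding pointwise_holder_def by simp
qed

lemma holder_exponent_levy_translated:
  assumes b: "b \<ge> 2" and \<alpha>: "\<alpha> > 0"
  shows "holder_exponent (levy_translated b \<alpha> y) x = ereal \<alpha> / approx_exponent b (x - y)"
proof -
  have "levy_translated b \<alpha> y = (\<lambda>x. levy b \<alpha> (x - y))"
    by (rule ext) (simp add: levy_translated_def levy_def)
  then have "holder_exponent (levy_translated b \<alpha> y) x = holder_exponent (levy b \<alpha>) (x - y)"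
    by (simp add: holder_exponent_def pointwise_holder_translate)
  then show ?thesis using holder_exponent_levy[OF assms] by simp
qed

section \<open>Hausdorff measure estimates\<close>

lemma diameter_cball_real: "0 \<le> r \<Longrightarrow> diameter (cball (c::real) r) = 2 * r"
  by (simp add: cball_eq_atLeastAtMost)

lemma hausdorff_premeasure_le_suminf:
  assumes "A \<subseteq> (\<Union>i. U i)" "\<And>i. bounded (U i)" "\<And>i. diameter (U i) \<le> \<delta>"
  shows "hausdorff_premeasure s \<delta> A \<le> (\<Sum>i. ennreal (diam_powr s (U i)))"
  unfolding hausdorff_premeasure_def using assms by (intro Inf_lower) blast

lemma hausdorff_measure_mono: "A \<subseteq> B \<Longrightarrow> hausdorff_measure s A \<le> hausdorff_measure s B"
  unfolding hausdorff_measure_def hausdorff_premeasure_def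
  by (intro SUP_mono' Inf_superset_mono) blast

text \<open>This is the convergence half of the Borel-Cantelli argument: the balls of all
  generations from \<open>m\<close> on still cover \<open>A\<close>, and their total cost is a tail
  of a convergent series.\<close>

lemma hausdorff_measure_limsup_balls_eq_0:
  fixes c :: "nat \<Rightarrow> nat \<Rightarrow> real" and \<rho> :: "nat \<Rightarrow> real"
  assumes s: "s > 0" and \<rho>: "\<And>n. 0 \<le> \<rho> n" "\<rho> \<longlonglongrightarrow> 0"
    and summable: "summable (\<lambda>n. real (N n) * (2 * \<rho> n) powr s)"
    and A: "\<And>x. x \<in> A \<Longrightarrow> \<exists>\<^sub>\<infinity>n. \<exists>k<N n. \<bar>x - c n k\<bar> \<le> \<rho> n"
  shows "hausdorff_measure s A = 0"
proof -
  have "hausdorff_premeasure s \<delta> A = 0" if \<delta>: "\<delta> > 0" for \<delta>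
  proof -
    have le: "hausdorff_premeasure s \<delta> A \<le> ennreal e" if e: "e > 0" for e
    proof -
      define S where "S = (\<lambda>n. real (N n) * (2 * \<rho> n) powr s)"
      have Sn: "S n \<ge> 0" for n by (simp add: S_def)
      have sumS: "summable S" using summable by (simp add: S_def)
      have "eventually (\<lambda>n. 2 * \<rho> n < \<delta>) sequentially"
        using order_tendstoD(2)[OF \<rho>(2), of "\<delta>/2"] \<delta> by (auto elim: eventually_mono)
      moreover have "eventually (\<lambda>n. (\<Sum>i. S (i + n)) < e) sequentially"
        using order_tendstoD(2)[OF suminf_exist_split2[OF sumS] e] .
      ultimately have "eventually (\<lambda>m. (\<forall>n\<ge>m. 2 * \<rho> n < \<delta>) \<and> (\<Sum>i. S (i + m)) < e) sequentially"
        by (intro eventually_conj eventually_all_ge_at_top)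
      then obtain m where m: "\<And>n. n \<ge> m \<Longrightarrow> 2 * \<rho> n < \<delta>" "(\<Sum>i. S (i + m)) < e"
        by (auto simp: eventually_sequentially)
      \<comment> \<open>The finite generations are padded with empty sets, which cost 0, so that
        \<open>prod_decode\<close> turns the double family into one sequence.\<close>
      define V where "V = (\<lambda>(n, k). if k < N (n + m) then cball (c (n + m) k) (\<rho> (n + m)) else {})"
      define U where "U = (\<lambda>i. V (prod_decode i))"
      have bV: "bounded (V p)" "diameter (V p) \<le> \<delta>" for p
        using m(1)[of "fst p + m"] \<delta> \<rho>(1)[of "fst p + m"]
        by (cases p; simp add: V_def diameter_cball_real)+
      have "A \<subseteq> (\<Union>i. U i)"
      proof
        fix x assume "x \<in> A"
        then obtain n k where nk: "n \<ge> m" "k < N n" "\<bar>x - c n k\<bar> \<le> \<rho> n"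
          using A[of x] unfolding INFM_nat_le by blast
        then have "x \<in> V (n - m, k)" by (auto simp: V_def dist_real_def abs_minus_commute)
        then have "x \<in> U (prod_encode (n - m, k))" by (simp add: U_def)
        then show "x \<in> (\<Union>i. U i)" by blast
      qed
      then have "hausdorff_premeasure s \<delta> A \<le> (\<Sum>i. ennreal (diam_powr s (U i)))"
        using bV by (intro hausdorff_premeasure_le_suminf) (auto simp: U_def)
      also have "\<dots> = (\<Sum>n. \<Sum>k. ennreal (diam_powr s (V (n, k))))"
        unfolding U_def by (rule suminf_ennreal_2dimen) simp
      also have "(\<lambda>n. \<Sum>k. ennreal (diam_powr s (V (n, k)))) = (\<lambda>n. ennreal (S (n + m)))"
      proof
        fix n
        have "(\<Sum>k. ennreal (diam_powr s (V (n, k)))) = (\<Sum>k<N (n + m). ennreal (diam_powr s (V (n, k))))"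
          by (rule suminf_finite) (auto simp: V_def diam_powr_def)
        also have "\<dots> = (\<Sum>k<N (n + m). ennreal ((2 * \<rho> (n + m)) powr s))"
          using s \<rho>(1) by (intro sum.cong) (auto simp: V_def diam_powr_def diameter_cball_real not_less)
        also have "\<dots> = ennreal (S (n + m))"
          by (simp add: S_def ennreal_of_nat_eq_real_of_nat ennreal_mult)
        finally show "(\<Sum>k. ennreal (diam_powr s (V (n, k)))) = ennreal (S (n + m))" .
      qed
      also have "(\<Sum>n. ennreal (S (n + m))) = ennreal (\<Sum>n. S (n + m))"
        using sumS Sn by (intro suminf_ennreal2) (auto simp: summable_iff_shift)
      also have "\<dots> \<le> ennreal e" using m(2) by (intro ennreal_leI) auto
      finally show ?thesis .
    qed
    have "hausdorff_premeasure s \<delta> A \<le> 0"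
      by (rule ennreal_le_epsilon) (simp add: le)
    then show ?thesis using le_zero_eq by blast
  qed
  then have "hausdorff_measure s A = (SUP \<delta>\<in>{0<..}::real set. 0)"
    unfolding hausdorff_measure_def by (intro SUP_cong) auto
  then show ?thesis by simp
qed

text \<open>The easy half of the Jarnik-Besicovitch theorem: about \<open>2 n b ^ n\<close> balls of
  radius \<open>b powr (- n a)\<close> have a cost of order \<open>n * b powr (n (1 - t a))\<close>,
  which is summable.\<close>

lemma hausdorff_measure_approx_exponent_gt_eq_0:
  assumes b: "b \<ge> 2" and a: "a > 0" and t: "t * a > 1"
  shows "hausdorff_measure t {x. ereal a < approx_exponent b (x - y)} = 0"
proof (rule hausdorff_measure_limsup_balls_eq_0)
  have b0: "real b > 1" using b by simp
  show t0: "t > 0" using a t zero_less_mult_pos2[of t a] by linarith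
  define \<rho> where "\<rho> = (\<lambda>n. real b powr (- real n * a))"
  show "0 \<le> \<rho> n" for n by (simp add: \<rho>_def)
  have \<rho>_eq: "\<rho> = (\<lambda>n. (real b powr (- a)) ^ n)"
    using b0 by (auto simp: \<rho>_def fun_eq_iff powr_powr mult.commute simp flip: powr_realpow)
  show "\<rho> \<longlonglongrightarrow> 0" unfolding \<rho>_eq using b0 a by (intro LIMSEQ_realpow_zero) (auto simp: powr_less_one)
  \<comment> \<open>The centres are \<open>y + z / b ^ n\<close> with
    \<open>\<bar>z\<bar> \<le> n * b ^ n\<close>, shifted to natural indices. The window around
    \<open>y\<close> grows with \<open>n\<close>, so it eventually serves every real
    \<open>x\<close>.\<close>
  define N where "N = (\<lambda>n. 2 * (n * b ^ n) + 1)"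
  define c where "c = (\<lambda>n k. y + (real k - real (n * b ^ n)) / real b ^ n)"
  define q where "q = real b powr (1 - t * a)"
  have q: "0 < q" "q < 1" using b0 t by (auto simp: q_def powr_less_one)
  have bound: "real (N n) * (2 * \<rho> n) powr t \<le> 2 powr t * 2 * (real (Suc n) * q ^ n)" for n
  proof -
    have "(2 * \<rho> n) powr t = 2 powr t * real b powr (- real n * a * t)"
      by (simp add: \<rho>_def powr_mult powr_powr)
    moreover have "real (N n) \<le> 2 * (real (Suc n) * real b ^ n)"
      using one_le_power[OF less_imp_le[OF b0], of n] unfolding N_def by (simp add: algebra_simps)
    moreover have "real b ^ n * real b powr (- real n * a * t) = q ^ n"
      using b0 by (simp add: q_def powr_powr algebra_simps flip: powr_realpow powr_add)
    ultimately show ?thesis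
      using mult_right_mono[of "real (N n)" "2 * (real (Suc n) * real b ^ n)" "2 powr t * real b powr (- real n * a * t)"]
      by (simp add: mult_ac)
  qed
  have "summable (\<lambda>n. real (Suc n) * q ^ n)"
    using geometric_deriv_sums[of q] q by (auto simp: sums_iff)
  then have "summable (\<lambda>n. 2 powr t * 2 * (real (Suc n) * q ^ n))"
    by (rule summable_mult)
  then show "summable (\<lambda>n. real (N n) * (2 * \<rho> n) powr t)"
    by (rule summable_comparison_test'[where N = 0]) (use bound in auto)
  fix x assume "x \<in> {x. ereal a < approx_exponent b (x - y)}"
  then have inf: "\<exists>\<^sub>\<infinity>n. dist_nearest_int (real b ^ n * (x - y)) \<le> real b powr (- real n * (a - 1))"
    using approx_exponent_gtD[OF b] by (simp add: INFM_iff_infinite)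
  have "\<forall>\<^sub>\<infinity>n. \<bar>x - y\<bar> + 1 \<le> real n"
    unfolding cofinite_eq_sequentially eventually_sequentially
    by (intro exI[of _ "nat \<lceil>\<bar>x - y\<bar> + 1\<rceil>"]) linarith
  from INFM_conjI[OF inf this]
  show "\<exists>\<^sub>\<infinity>n. \<exists>k<N n. \<bar>x - c n k\<bar> \<le> \<rho> n"
  proof (rule INFM_mono)
    fix n assume n: "dist_nearest_int (real b ^ n * (x - y)) \<le> real b powr (- real n * (a - 1)) \<and> \<bar>x - y\<bar> + 1 \<le> real n"
    define z where "z = round (real b ^ n * (x - y))"
    have bn: "real b ^ n \<ge> 1" using b0 by simp
    have "\<bar>real_of_int z\<bar> \<le> \<bar>real b ^ n * (x - y)\<bar> + 1"
      unfolding z_def using of_int_round_abs_le[of "real b ^ n * (x - y)"] by linarith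
    also have "\<bar>real b ^ n * (x - y)\<bar> + 1 \<le> real b ^ n * (\<bar>x - y\<bar> + 1)"
      using bn unfolding abs_mult distrib_left by simp
    also have "\<dots> \<le> real b ^ n * real n" using n bn by (intro mult_left_mono) auto
    finally have "\<bar>z\<bar> \<le> int (n * b ^ n)"
      by (metis mult.commute of_int_abs of_int_le_iff of_int_of_nat_eq of_nat_mult of_nat_power)
    define K where "K = nat (z + int (n * b ^ n))"
    have k: "K < N n" "real K = real_of_int z + real (n * b ^ n)"
      using \<open>\<bar>z\<bar> \<le> int (n * b ^ n)\<close> unfolding N_def K_def by linarith+
    have "\<bar>real b ^ n * (x - y) - z\<bar> \<le> real b powr (- real n * (a - 1))"
      using n by (simp add: dist_nearest_int_eq z_def)
    also have "real b powr (- real n * (a - 1)) = real b ^ n * \<rho> n"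
      using b0 by (simp add: \<rho>_def algebra_simps flip: powr_realpow powr_add)
    also have "real b ^ n * (x - y) - z = real b ^ n * (x - c n K)"
      using bn b0 by (simp add: c_def k(2) field_simps)
    finally have "real b ^ n * \<bar>x - c n K\<bar> \<le> real b ^ n * \<rho> n"
      using bn by (simp add: abs_mult)
    then have "\<bar>x - c n K\<bar> \<le> \<rho> n" by (rule mult_left_le_imp_le) (use bn in linarith)
    with k show "\<exists>k<N n. \<bar>x - c n k\<bar> \<le> \<rho> n" by blast
  qed
qed

lemma diam_powr_nonneg: "0 \<le> diam_powr t U"
  by (simp add: diam_powr_def)

text \<open>Mass distribution principle without measures on the fractal: a cover of \<open>A\<close> is pulled back
  along \<open>X\<close> to a cover of the unit interval.\<close>
lemma hausdorff_measure_neq_0: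
  fixes X :: "real \<Rightarrow> real"
  assumes C: "C > 0" and t: "t \<ge> 0"
    and X: "\<And>u. u \<in> {0..<1} \<Longrightarrow> X u \<in> A"
    and hoelder: "\<And>u v. u \<in> {0..<1} \<Longrightarrow> v \<in> {0..<1} \<Longrightarrow> \<bar>u - v\<bar> \<le> C * \<bar>X u - X v\<bar> powr t"
  shows "hausdorff_measure t A \<noteq> 0"
proof
  assume "hausdorff_measure t A = 0"
  moreover have "hausdorff_premeasure t 1 A \<le> hausdorff_measure t A"
    unfolding hausdorff_measure_def by (rule SUP_upper) simp
  \<comment> \<open>Each covering set will yield an interval of length \<open>2 C\<close> times its
    cost, so below this threshold the total length is less than 1.\<close>
  ultimately have "hausdorff_premeasure t 1 A < ennreal (1 / (2 * C))"
    using C by (simp add: ennreal_zero_less_divide order_le_less_trans)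
  then obtain U :: "nat \<Rightarrow> real set" where U: "A \<subseteq> (\<Union>i. U i)" "\<And>i. bounded (U i)"
    "(\<Sum>i. ennreal (diam_powr t (U i))) < ennreal (1 / (2 * C))"
    unfolding hausdorff_premeasure_def Inf_less_iff by auto
  define V where "V = (\<lambda>i. {u\<in>{0..<1}. X u \<in> U i})"
  \<comment> \<open>If \<open>V i\<close> is empty, the chosen value is arbitrary and the inclusion
    \<open>V i \<subseteq> W i\<close> holds trivially.\<close>
  define c where "c = (\<lambda>i. SOME u. u \<in> V i)"
  define L where "L = (\<lambda>i. C * diam_powr t (U i))"
  define W where "W = (\<lambda>i. {c i - L i..c i + L i})"
  have VW: "V i \<subseteq> W i" for i
  proof
    fix u assume u: "u \<in> V i"
    then have c: "c i \<in> V i" unfolding c_def by (rule someI)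
    have "\<bar>u - c i\<bar> \<le> C * \<bar>X u - X (c i)\<bar> powr t"
      using u c by (intro hoelder) (auto simp: V_def)
    also have "\<dots> \<le> L i"
    proof -
      have "\<bar>X u - X (c i)\<bar> \<le> diameter (U i)"
        using diameter_bounded_bound[OF U(2), of "X u" i "X (c i)"] u c by (auto simp: V_def dist_real_def)
      then have "\<bar>X u - X (c i)\<bar> powr t \<le> diam_powr t (U i)"
        using t u by (auto simp: diam_powr_def V_def intro: powr_mono2)
      then show ?thesis using C by (simp add: L_def)
    qed
    finally show "u \<in> W i" by (auto simp: W_def)
  qed
  have L0: "L i \<ge> 0" for i using C by (simp add: L_def diam_powr_nonneg)
  have "{0..<1} \<subseteq> (\<Union>i. W i)"
  proof
    fix u :: real assume u: "u \<in> {0..<1}"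
    then obtain i where "X u \<in> U i" using X U(1) by blast
    then have "u \<in> V i" using u by (simp add: V_def)
    then show "u \<in> (\<Union>i. W i)" using VW by blast
  qed
  then have "emeasure lborel {0..<1::real} \<le> emeasure lborel (\<Union>i. W i)"
    by (intro emeasure_mono) (auto simp: W_def)
  also have "\<dots> \<le> (\<Sum>i. emeasure lborel (W i))"
    by (intro emeasure_subadditive_countably) (auto simp: W_def)
  also have "\<dots> = (\<Sum>i. ennreal (2 * C) * ennreal (diam_powr t (U i)))"
  proof (intro suminf_cong)
    fix i
    have "emeasure lborel (W i) = ennreal (2 * L i)" using L0[of i] by (simp add: W_def)
    then show "emeasure lborel (W i) = ennreal (2 * C) * ennreal (diam_powr t (U i))"
      using C by (subst ennreal_mult[symmetric]) (auto simp: L_def mult.assoc diam_powr_nonneg)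
  qed
  also have "\<dots> = ennreal (2 * C) * (\<Sum>i. ennreal (diam_powr t (U i)))" by simp
  also have "\<dots> < ennreal (2 * C) * ennreal (1 / (2 * C))"
    using U(3) C by (intro ennreal_mult_strict_left_mono) auto
  also have "\<dots> = 1" using C by (subst ennreal_mult[symmetric]) auto
  finally show False by simp
qed

section \<open>Digit expansions\<close>

text \<open>The number with digits \<open>d j\<close>, \<open>d (j + 1)\<close>, ... after the point
  in base \<open>B\<close>; it can equal 1, when all these digits are \<open>B - 1\<close>.\<close>

definition expansion_tail :: "nat \<Rightarrow> (nat \<Rightarrow> nat) \<Rightarrow> nat \<Rightarrow> real" where
  "expansion_tail B d j = (\<Sum>l. real (d (j + l)) / real B ^ Suc l)"

definition base_digit :: "nat \<Rightarrow> real \<Rightarrow> nat \<Rightarrow> nat" where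
  "base_digit B y j = nat \<lfloor>real B * frac (real B ^ j * y)\<rfloor>"

lemma geometric_digit_sums:
  assumes "B \<ge> 2"
  shows "(\<lambda>l. K / real B ^ Suc l) sums (K / (real B - 1))"
proof -
  have "(\<lambda>l. K / real B * (1 / real B) ^ l) sums (K / real B * (1 / (1 - 1 / real B)))"
    using assms by (intro sums_mult geometric_sums) auto
  moreover have "K / real B * (1 / (1 - 1 / real B)) = K / (real B - 1)"
    using assms by (simp add: field_simps)
  moreover have "(\<lambda>l. K / real B * (1 / real B) ^ l) = (\<lambda>l. K / real B ^ Suc l)"
    by (auto simp: field_simps)
  ultimately show ?thesis by metis
qed

lemma summable_expansion:
  assumes "B \<ge> 2" "\<And>l. d l < B"
  shows "summable (\<lambda>l. real (d (j + l)) / real B ^ Suc l)"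
proof (rule summable_comparison_test'[where N = 0])
  show "summable (\<lambda>l. real B / real B ^ Suc l)"
    using geometric_digit_sums[OF assms(1)] by (rule sums_summable)
  show "norm (real (d (j + l)) / real B ^ Suc l) \<le> real B / real B ^ Suc l" for l
    using assms(2)[of "j + l"] by (auto simp del: power_Suc intro!: divide_right_mono)
qed

lemma expansion_tail_nonneg: "B \<ge> 2 \<Longrightarrow> (\<And>l. d l < B) \<Longrightarrow> 0 \<le> expansion_tail B d j"
  unfolding expansion_tail_def by (intro suminf_nonneg summable_expansion) auto

lemma expansion_tail_le_1:
  assumes "B \<ge> 2" "\<And>l. d l < B"
  shows "expansion_tail B d j \<le> 1"
proof -
  have "expansion_tail B d j \<le> (\<Sum>l. (real B - 1) / real B ^ Suc l)"
    unfolding expansion_tail_def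
  proof (rule suminf_le)
    fix l
    have "real (d (j + l)) \<le> real B - 1" using assms(2)[of "j + l"] by linarith
    then show "real (d (j + l)) / real B ^ Suc l \<le> (real B - 1) / real B ^ Suc l"
      by (rule divide_right_mono) simp
  qed (use summable_expansion[OF assms] geometric_digit_sums[OF assms(1)] in \<open>auto intro: sums_summable\<close>)
  also have "\<dots> = 1" using geometric_digit_sums[OF assms(1), of "real B - 1"] assms(1) by (simp add: sums_iff)
  finally show ?thesis .
qed

lemma expansion_tail_Suc:
  assumes "B \<ge> 2" "\<And>l. d l < B"
  shows "real B * expansion_tail B d j = real (d j) + expansion_tail B d (Suc j)"
proof -
  have "expansion_tail B d j = real (d j) / real B + (\<Sum>l. real (d (j + Suc l)) / real B ^ Suc (Suc l))"
    using suminf_split_head[OF summable_expansion[of B d j]] assms by (simp add: expansion_tail_def)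
  also have "(\<lambda>l. real (d (j + Suc l)) / real B ^ Suc (Suc l)) = (\<lambda>l. (real (d (Suc j + l)) / real B ^ Suc l) / real B)"
    by (simp add: field_simps)
  also have "(\<Sum>l. (real (d (Suc j + l)) / real B ^ Suc l) / real B) = expansion_tail B d (Suc j) / real B"
    unfolding expansion_tail_def by (intro suminf_divide summable_expansion assms)
  finally show ?thesis using assms(1) by (simp add: field_simps)
qed

lemma expansion_tail_power:
  assumes "B \<ge> 2" "\<And>l. d l < B"
  shows "\<exists>k::int. real B ^ j * expansion_tail B d 0 = expansion_tail B d j + of_int k"
proof (induction j)
  case (Suc j)
  then obtain k :: int where k: "real B ^ j * expansion_tail B d 0 = expansion_tail B d j + of_int k" by blast
  have "real B ^ Suc j * expansion_tail B d 0 = real B * (real B ^ j * expansion_tail B d 0)" by simp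
  also have "\<dots> = expansion_tail B d (Suc j) + of_int (int (d j) + int B * k)"
    unfolding k distrib_left expansion_tail_Suc[OF assms] by simp
  finally show ?case by blast
qed simp

lemma base_digit_less: "B \<ge> 1 \<Longrightarrow> base_digit B y j < B"
proof -
  assume "B \<ge> 1"
  then have "real B * frac (real B ^ j * y) < real B" by (simp add: frac_lt_1)
  then have "\<lfloor>real B * frac (real B ^ j * y)\<rfloor> < int B" by linarith
  then show ?thesis using \<open>B \<ge> 1\<close> unfolding base_digit_def by linarith
qed

lemma base_digit_bounds:
  "real (base_digit B y j) \<le> real B * frac (real B ^ j * y)"
  "real B * frac (real B ^ j * y) < real (base_digit B y j) + 1"
proof -
  have "0 \<le> real B * frac (real B ^ j * y)" by simp
  then show "real (base_digit B y j) \<le> real B * frac (real B ^ j * y)"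
    "real B * frac (real B ^ j * y) < real (base_digit B y j) + 1"
    unfolding base_digit_def by linarith+
qed

lemma frac_power_Suc: "frac (real B ^ Suc j * y) = real B * frac (real B ^ j * y) - real (base_digit B y j)"
proof -
  have nn: "0 \<le> real B * frac (real B ^ j * y)" by simp
  have "frac (real B ^ Suc j * y) = frac (real B * frac (real B ^ j * y) + of_int (int B * \<lfloor>real B ^ j * y\<rfloor>))"
    by (simp add: frac_def algebra_simps)
  also have "\<dots> = frac (real B * frac (real B ^ j * y))" by (simp add: frac_def)
  also have "\<dots> = real B * frac (real B ^ j * y) - real (base_digit B y j)"
    unfolding base_digit_def using nn by (simp add: frac_def[of "real B * _"])
  finally show ?thesis .
qed

lemma dist_nearest_int_expansion:
  assumes "B \<ge> 2" "\<And>l. d l < B"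
  shows "dist_nearest_int (real B ^ j * (expansion_tail B d 0 - y))
    = dist_nearest_int (expansion_tail B d j - frac (real B ^ j * y))"
proof -
  obtain k :: int where k: "real B ^ j * expansion_tail B d 0 = expansion_tail B d j + of_int k"
    using expansion_tail_power[of B d j] assms by blast
  have "real B ^ j * (expansion_tail B d 0 - y) = (expansion_tail B d j - frac (real B ^ j * y)) + of_int (k - \<lfloor>real B ^ j * y\<rfloor>)"
    unfolding right_diff_distrib k by (simp add: frac_def)
  then show ?thesis by (simp only: dist_nearest_int_add_int)
qed

text \<open>Leading digits that differ by at least 2 keep the two tails \<open>1 / B\<close> apart
  despite carries. Excluding the digits 0 and \<open>B - 1\<close> also keeps the difference
  \<open>1 / B\<close> away from 1 and -1.\<close>

lemma dist_nearest_int_expansion_ge: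
  assumes B: "B \<ge> 2" "\<And>l. d l < B" and d: "1 \<le> d j" "d j \<le> B - 2"
    and c: "d j \<noteq> base_digit B y j - 1" "d j \<noteq> base_digit B y j" "d j \<noteq> base_digit B y j + 1"
  shows "1 / real B \<le> dist_nearest_int (real B ^ j * (expansion_tail B d 0 - y))"
proof -
  define c where "c = base_digit B y j"
  define \<tau> \<theta> where "\<tau> = expansion_tail B d j" and "\<theta> = frac (real B ^ j * y)"
  have \<tau>: "real (d j) \<le> real B * \<tau>" "real B * \<tau> \<le> real (d j) + 1"
    unfolding \<tau>_def using expansion_tail_Suc[of B d j] B expansion_tail_nonneg[of B d "Suc j"]
      expansion_tail_le_1[of B d "Suc j"] by auto
  have \<theta>: "real c \<le> real B * \<theta>" "real B * \<theta> < real c + 1" "0 \<le> \<theta>" "\<theta> < 1"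
    unfolding \<theta>_def c_def using base_digit_bounds frac_lt_1 by auto
  have \<theta>B: "0 \<le> real B * \<theta>" "real B * \<theta> \<le> real B" using \<theta> B by (auto simp: mult_left_le)
  \<comment> \<open>For \<open>c = 0\<close> the truncated \<open>c - 1\<close> is again 0, a digit
    that \<open>1 \<le> d j\<close> excludes anyway.\<close>
  have "d j + 2 \<le> c \<or> c + 2 \<le> d j" using d c(1-3)[folded c_def] by arith
  then have "real (d j) + 2 \<le> real c \<or> real c + 2 \<le> real (d j)" by linarith
  then have 1: "1 \<le> \<bar>real B * \<tau> - real B * \<theta>\<bar>" using \<tau> \<theta> by linarith
  have "real (d j) \<le> real B - 2" "1 \<le> real (d j)" using d B by linarith+
  then have 2: "\<bar>real B * \<tau> - real B * \<theta>\<bar> \<le> real B - 1" using \<tau> \<theta>B by linarith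
  have "real B * \<tau> - real B * \<theta> = real B * (\<tau> - \<theta>)" by (simp add: algebra_simps)
  then have 3: "\<bar>real B * \<tau> - real B * \<theta>\<bar> = real B * \<bar>\<tau> - \<theta>\<bar>" by (simp add: abs_mult)
  have "1 / real B \<le> dist_nearest_int (\<tau> - \<theta>)"
    using 1 2 B(1) unfolding 3 by (intro dist_nearest_int_geI) (auto simp: field_simps)
  then show ?thesis unfolding \<tau>_def \<theta>_def using dist_nearest_int_expansion[of B d] B by simp
qed

text \<open>Each common digit cancels when the difference of the tails is multiplied by
  \<open>B\<close>; at position \<open>e\<close> a difference of at most 1 remains. The induction
  runs downwards from \<open>e\<close>.\<close>

lemma dist_nearest_int_expansion_le:
  assumes B: "B \<ge> 2" "\<And>l. d l < B" and "n \<le> e"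
    and d: "\<And>l. n \<le> l \<Longrightarrow> l < e \<Longrightarrow> d l = base_digit B y l"
  shows "dist_nearest_int (real B ^ n * (expansion_tail B d 0 - y)) \<le> 1 / real B ^ (e - n)"
proof -
  have "real B ^ (e - n) * \<bar>expansion_tail B d n - frac (real B ^ n * y)\<bar> \<le> 1"
    using \<open>n \<le> e\<close> d
  proof (induction n rule: inc_induct)
    case base
    show ?case using expansion_tail_nonneg[of B d e] expansion_tail_le_1[of B d e] B
        frac_ge_0[of "real B ^ e * y"] frac_lt_1[of "real B ^ e * y"] by (simp del: frac_ge_0)
  next
    case (step n)
    have "real B * (expansion_tail B d n - frac (real B ^ n * y))
        = expansion_tail B d (Suc n) - frac (real B ^ Suc n * y)"
      using expansion_tail_Suc[of B d n] B step.prems[of n] step.hyps unfolding frac_power_Suc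
      by (simp add: algebra_simps)
    then have "real B * \<bar>expansion_tail B d n - frac (real B ^ n * y)\<bar>
        = \<bar>expansion_tail B d (Suc n) - frac (real B ^ Suc n * y)\<bar>"
      by (metis abs_mult abs_of_nat)
    moreover have "e - n = Suc (e - Suc n)" using step.hyps by simp
    moreover have "real B ^ (e - Suc n) * \<bar>expansion_tail B d (Suc n) - frac (real B ^ Suc n * y)\<bar> \<le> 1"
      by (rule step.IH) (use step.prems in simp)
    ultimately show ?case by (simp only: power_Suc2 mult.assoc)
  qed
  then have "\<bar>expansion_tail B d n - frac (real B ^ n * y)\<bar> \<le> 1 / real B ^ (e - n)"
    using B by (simp add: field_simps)
  then show ?thesis
    using dist_nearest_int_le[of "expansion_tail B d n - frac (real B ^ n * y)" 0]
      dist_nearest_int_expansion[of B d n y] B by simp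
qed

text \<open>The bound \<open>B - 3\<close> on the digit differences limits the later contribution to
  \<open>(B - 3) / (B - 1)\<close>, so it cannot cancel the first difference as trailing digits
  \<open>B - 1\<close> could. What remains is at least \<open>2 / (B - 1)\<close>.\<close>

lemma expansion_diff_ge:
  assumes B: "B \<ge> 4" "\<And>l. d l < B" "\<And>l. d' l < B"
    and close: "\<And>l. \<bar>real (d l) - real (d' l)\<bar> \<le> real B - 3"
    and eq: "\<And>l. l < j \<Longrightarrow> d l = d' l" and neq: "d j \<noteq> d' j"
  shows "1 / real B ^ (j + 2) \<le> \<bar>expansion_tail B d 0 - expansion_tail B d' 0\<bar>"
proof -
  have B2: "B \<ge> 2" using B by simp
  define \<tau> where "\<tau> = (\<lambda>j. expansion_tail B d j - expansion_tail B d' j)"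
  have tSuc: "real B * \<tau> l = (real (d l) - real (d' l)) + \<tau> (Suc l)" for l
    unfolding \<tau>_def right_diff_distrib
    using expansion_tail_Suc[of B d l] expansion_tail_Suc[of B d' l] B B2 by simp
  have \<tau>0: "real B ^ l * \<tau> 0 = \<tau> l" if "l \<le> j" for l
    using that
  proof (induction l)
    case (Suc l)
    then have "real B ^ l * \<tau> 0 = \<tau> l" "d l = d' l" using eq[of l] by auto
    then show ?case using tSuc[of l] by (simp add: mult.assoc)
  qed simp
  have "\<bar>\<tau> (Suc j)\<bar> \<le> (real B - 3) / (real B - 1)"
  proof -
    have "(\<lambda>l. (real (d (Suc j + l)) - real (d' (Suc j + l))) / real B ^ Suc l) sums \<tau> (Suc j)"
      unfolding \<tau>_def expansion_tail_def diff_divide_distrib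
      using B B2 by (intro sums_diff summable_sums summable_expansion) auto
    moreover have "norm ((real (d (Suc j + l)) - real (d' (Suc j + l))) / real B ^ Suc l) \<le> (real B - 3) / real B ^ Suc l" for l
      using close[of "Suc j + l"] by (simp add: abs_mult divide_right_mono del: power_Suc)
    ultimately show ?thesis
      using geometric_digit_sums[OF B2, of "real B - 3"] by (metis (no_types, lifting) norm_suminf_le real_norm_def sums_iff)
  qed
  moreover have "1 \<le> \<bar>real (d j) - real (d' j)\<bar>" using neq by linarith
  ultimately have "1 - (real B - 3) / (real B - 1) \<le> \<bar>real B * \<tau> j\<bar>" using tSuc[of j] by linarith
  moreover have "1 - (real B - 3) / (real B - 1) \<ge> 1 / real B" using B by (simp add: field_simps)
  ultimately have "1 / real B \<le> \<bar>real B * (real B ^ j * \<tau> 0)\<bar>" using \<tau>0[of j] by simp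
  also have "\<dots> = real B ^ Suc j * \<bar>\<tau> 0\<bar>" by (simp add: abs_mult)
  finally show ?thesis using B by (simp add: \<tau>_def field_simps)
qed

text \<open>The floor at level \<open>Suc k\<close> is determined by its quotient by
  \<open>M\<close>, which is the floor at level \<open>k\<close>, and its remainder.\<close>

lemma floor_power_agree:
  assumes M: "M \<ge> 1" and "\<lfloor>real M ^ k * u\<rfloor> = \<lfloor>real M ^ k * v\<rfloor>"
    "\<lfloor>real M ^ Suc k * u\<rfloor> mod int M = \<lfloor>real M ^ Suc k * v\<rfloor> mod int M"
  shows "\<lfloor>real M ^ Suc k * u\<rfloor> = \<lfloor>real M ^ Suc k * v\<rfloor>"
proof -
  have "\<lfloor>real M ^ Suc k * w\<rfloor> div int M = \<lfloor>real M ^ k * w\<rfloor>" for w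
    using floor_divide_real_eq_div[of "int M" "real M ^ Suc k * w"] M by simp
  then show ?thesis using assms(2,3) by (metis mult_div_mod_eq)
qed

section \<open>The Cantor construction\<close>

text \<open>The constant 8 counts the excluded digits: 0, \<open>B - 1\<close>, and three around the
  digit of each of \<open>y1\<close> and \<open>y2\<close>, so that at least \<open>M\<close>
  remain. By \<open>compat\<close>, copying digits of \<open>y1\<close> does not bring a point too
  close to \<open>y2\<close> when the exponents differ.\<close>

locale approximation_tree =
  fixes B M :: nat and y1 y2 :: real and \<delta>1 \<delta>2 :: ereal
  assumes M: "M \<ge> 2" and B: "B = M + 8" and \<delta>2: "1 \<le> \<delta>2" and \<delta>21: "\<delta>2 \<le> \<delta>1"
    and compat: "\<delta>1 = \<delta>2 \<or> approx_exponent B (y1 - y2) \<le> \<delta>2"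
begin

definition target_exponent :: "nat \<Rightarrow> ereal" where
  "target_exponent i = (if even i then \<delta>1 else \<delta>2)"

definition target :: "nat \<Rightarrow> real" where
  "target i = (if even i then y1 else y2)"

text \<open>Truncated so that it is finite even for an infinite exponent.\<close>
definition ratio :: "nat \<Rightarrow> real" where
  "ratio i = real_of_ereal (min (target_exponent i) (ereal (real (Suc i))))"

text \<open>The inner \<open>nat\<close> term is the end \<open>stop i\<close> of the window. The
  factor \<open>i + 2\<close> makes everything up to that end a negligible part of
  \<open>start (Suc i)\<close>, so almost all positions before a late window are free.\<close>

primrec start :: "nat \<Rightarrow> nat" where
  "start 0 = 1"
| "start (Suc i) = (i + 2) * Suc (nat \<lfloor>ratio i * real (start i)\<rfloor>)"

declare start.simps(2) [simp del]

definition stop :: "nat \<Rightarrow> nat" where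
  "stop i = nat \<lfloor>ratio i * real (start i)\<rfloor>"

text \<open>The window that begins last at or before \<open>j\<close>. Position 0 precedes all
  windows; it also has index 0 but is not forced.\<close>

definition index :: "nat \<Rightarrow> nat" where
  "index j = (LEAST i. j < start (Suc i))"

definition forced :: "nat \<Rightarrow> bool" where
  "forced j \<longleftrightarrow> start (index j) \<le> j \<and> j < stop (index j)"

definition allowed :: "nat \<Rightarrow> nat set" where
  "allowed j = {1..B - 2} - (\<Union>y\<in>{y1, y2}. {base_digit B y j - 1, base_digit B y j, base_digit B y j + 1})"

definition admissible :: "(nat \<Rightarrow> nat) \<Rightarrow> bool" where
  "admissible d \<longleftrightarrow>
     (\<forall>j. if forced j then d j = base_digit B (target (index j)) j else d j \<in> allowed j)"

section \<open>Positions of the windows and the supply of digits\<close>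

lemma B_ge: "B \<ge> 10" using M B by simp

lemma target_exponent_ge_1: "1 \<le> target_exponent i"
  using \<delta>2 \<delta>21 by (auto simp: target_exponent_def)

lemma ereal_ratio: "ereal (ratio i) = min (target_exponent i) (ereal (real (Suc i)))"
  using target_exponent_ge_1[of i] unfolding ratio_def
  by (cases "target_exponent i") (auto simp: min_def)

lemma ratio_ge_1: "1 \<le> ratio i"
proof -
  have "ereal 1 \<le> ereal (ratio i)"
    unfolding ereal_ratio using target_exponent_ge_1[of i] by (auto simp: one_ereal_def)
  then show ?thesis by simp
qed

lemma ratio_le: "ereal (ratio i) \<le> target_exponent i"
  unfolding ereal_ratio by simp

lemma less_ratio:
  assumes "ereal a < target_exponent i" "a < real (Suc i)"
  shows "a < ratio i"
proof -
  have "ereal a < ereal (ratio i)" unfolding ereal_ratio using assms by simp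
  then show ?thesis by simp
qed

lemma start_Suc: "start (Suc i) = (i + 2) * Suc (stop i)"
  by (simp add: stop_def start.simps(2))

lemma stop_bounds: "real (stop i) \<le> ratio i * real (start i)" "ratio i * real (start i) < real (stop i) + 1"
proof -
  have "0 \<le> ratio i * real (start i)" using ratio_ge_1[of i] by simp
  then show "real (stop i) \<le> ratio i * real (start i)" "ratio i * real (start i) < real (stop i) + 1"
    unfolding stop_def by linarith+
qed

lemma start_le_stop: "start i \<le> stop i"
  unfolding stop_def using ratio_ge_1[of i] mult_right_mono[of 1 "ratio i" "real (start i)"]
  by (simp add: le_nat_iff le_floor_iff)

lemma stop_less_start: "stop i < start (Suc i)"
  unfolding start_Suc by simp

lemma strict_mono_start: "strict_mono start"
  unfolding strict_mono_Suc_iff using start_le_stop stop_less_start le_less_trans by blast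

lemma Suc_le_start: "Suc i \<le> start i"
proof (induction i)
  case (Suc i)
  then show ?case using strict_monoD[OF strict_mono_start, of i "Suc i"] by simp
qed simp

lemma index_eq: "start i \<le> j \<Longrightarrow> j < start (Suc i) \<Longrightarrow> index j = i"
  unfolding index_def
proof (rule Least_equality)
  fix k assume "start i \<le> j" "j < start (Suc k)"
  then have "start i < start (Suc k)" by simp
  then show "i \<le> k" using strict_mono_less[OF strict_mono_start] by simp
qed

lemma index_bounds:
  assumes "j \<ge> 1"
  shows "start (index j) \<le> j" "j < start (Suc (index j))"
proof -
  have "j < start (Suc j)" using Suc_le_start[of "Suc j"] by simp
  then show *: "j < start (Suc (index j))" unfolding index_def by (rule LeastI)
  show "start (index j) \<le> j"
  proof (cases "index j")
    case (Suc k)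
    then have "\<not> j < start (Suc k)" using not_less_Least[of k "\<lambda>i. j < start (Suc i)"] by (simp add: index_def)
    then show ?thesis using Suc by simp
  qed (use assms in simp)
qed

lemma le_index:
  assumes "start i \<le> j"
  shows "i \<le> index j"
proof -
  have "j \<ge> 1" using assms Suc_le_start[of i] by simp
  then have "start i < start (Suc (index j))" using index_bounds(2)[of j] assms by simp
  then show ?thesis using strict_mono_less[OF strict_mono_start] by simp
qed

lemma not_forced_after_stop: "stop i \<le> j \<Longrightarrow> j < start (Suc i) \<Longrightarrow> \<not> forced j"
  using index_eq[of i j] start_le_stop[of i] by (auto simp: forced_def)

lemma forced_in_window: "start i \<le> j \<Longrightarrow> j < stop i \<Longrightarrow> forced j \<and> index j = i"
  using index_eq[of i j] stop_less_start[of i] by (auto simp: forced_def)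

lemma finite_allowed: "finite (allowed j)" by (simp add: allowed_def)

lemma card_allowed: "M \<le> card (allowed j)"
proof -
  let ?U = "\<Union>y\<in>{y1, y2}. {base_digit B y j - 1, base_digit B y j, base_digit B y j + 1}"
  have "?U = set [base_digit B y1 j - 1, base_digit B y1 j, base_digit B y1 j + 1,
      base_digit B y2 j - 1, base_digit B y2 j, base_digit B y2 j + 1]" by auto
  then have "card ?U \<le> 6" using card_length[of "[base_digit B y1 j - 1, base_digit B y1 j, base_digit B y1 j + 1,
      base_digit B y2 j - 1, base_digit B y2 j, base_digit B y2 j + 1]"] by (simp del: set_simps)
  moreover have "card {1..B - 2} = M + 6" using B by simp
  moreover have "card {1..B - 2} - card ?U \<le> card (allowed j)"
    unfolding allowed_def by (rule diff_card_le_card_Diff) simp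
  ultimately show ?thesis by linarith
qed

lemma admissible_less:
  assumes "admissible d"
  shows "d l < B"
  using assms[unfolded admissible_def, rule_format, of l] base_digit_less[of B _ l] B_ge
  by (auto simp: allowed_def split: if_splits)

section \<open>Approximation exponents of the points with admissible digits\<close>

context
  fixes d :: "nat \<Rightarrow> nat"
  assumes adm: "admissible d"
begin

abbreviation "pt \<equiv> expansion_tail B d 0"

lemma dist_free:
  assumes "\<not> forced j" "y \<in> {y1, y2}"
  shows "1 / real B \<le> dist_nearest_int (real B ^ j * (pt - y))"
proof -
  have "d j \<in> allowed j" using adm assms(1) unfolding admissible_def by metis
  then have "1 \<le> d j" "d j \<le> B - 2" "d j \<noteq> base_digit B y j - 1" "d j \<noteq> base_digit B y j" "d j \<noteq> base_digit B y j + 1"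
    using assms(2) unfolding allowed_def by auto
  then show ?thesis
    using admissible_less[OF adm] B_ge by (intro dist_nearest_int_expansion_ge) auto
qed

text \<open>Position \<open>stop (index j)\<close> is free, so the distance there is at least
  \<open>1 / B\<close>, and each step back towards \<open>j\<close> loses at most a factor
  \<open>B\<close>. Past the end of the window the truncated subtraction leaves the bound
  \<open>1 / B\<close>.\<close>

lemma dist_ge:
  assumes "j \<ge> 1" "y \<in> {y1, y2}"
  shows "1 / real B ^ Suc (stop (index j) - j) \<le> dist_nearest_int (real B ^ j * (pt - y))"
proof (cases "stop (index j) \<le> j")
  case True
  then show ?thesis using dist_free[OF not_forced_after_stop assms(2)] index_bounds[OF assms(1)] by auto
next
  case False
  define e where "e = stop (index j)"
  have "1 / real B \<le> dist_nearest_int (real B ^ e * (pt - y))"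
    unfolding e_def by (intro dist_free not_forced_after_stop[OF order_refl] stop_less_start assms)
  also have "real B ^ e * (pt - y) = real (B ^ (e - j)) * (real B ^ j * (pt - y))"
    using False by (simp add: e_def flip: power_add mult.assoc)
  also have "dist_nearest_int \<dots> \<le> real (B ^ (e - j)) * dist_nearest_int (real B ^ j * (pt - y))"
    by (rule dist_nearest_int_mult)
  finally show ?thesis using B_ge by (simp add: e_def field_simps)
qed

lemma dist_le:
  assumes "start i \<le> j" "j \<le> stop i"
  shows "dist_nearest_int (real B ^ j * (pt - target i)) \<le> 1 / real B ^ (stop i - j)"
proof (rule dist_nearest_int_expansion_le)
  fix l assume "j \<le> l" "l < stop i"
  then show "d l = base_digit B (target i) l"
    using adm forced_in_window[of i l] assms unfolding admissible_def by (metis order_trans)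
qed (use admissible_less[OF adm] B_ge assms in auto)

text \<open>From the start of a window that copies this target the digits agree up to about
  \<open>ratio i\<close> times that position, and the truncated ratios eventually exceed every
  number below the exponent.\<close>

lemma approx_exponent_ge_target: "target_exponent k \<le> approx_exponent B (pt - target k)"
proof (rule approx_exponent_geI)
  show "B \<ge> 2" using B_ge by simp
  fix a assume a: "1 \<le> a" "ereal a < target_exponent k"
  then obtain c where c: "ereal a < ereal c" "ereal c < target_exponent k" using ereal_dense2 by blast
  show "infinite {n. dist_nearest_int (real B ^ n * (pt - target k)) \<le> real B powr (- real n * (a - 1))}"
    unfolding infinite_nat_iff_unbounded_le
  proof
    fix m
    \<comment> \<open>This \<open>i\<close> has the parity of \<open>k\<close>, is at least
      \<open>m\<close>, exceeds \<open>c\<close> so that the truncation in \<open>ratio\<close> does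
      no harm, and makes \<open>(c - a) * start i \<ge> 1\<close>, which pays for the floor in
      \<open>stop\<close>.\<close>
    define i where "i = 2 * (m + nat \<lceil>c\<rceil> + nat \<lceil>1 / (c - a)\<rceil>) + k"
    have t: "target i = target k" "target_exponent i = target_exponent k"
      by (simp_all add: target_def target_exponent_def i_def)
    have "real i = 2 * (real m + real (nat \<lceil>c\<rceil>) + real (nat \<lceil>1 / (c - a)\<rceil>)) + real k" by (simp add: i_def)
    then have i: "m \<le> i" "c < real (Suc i)" "1 / (c - a) \<le> real (Suc i)"
      using real_nat_ceiling_ge[of c] real_nat_ceiling_ge[of "1 / (c - a)"] by (simp_all add: i_def)
    have n: "real (Suc i) \<le> real (start i)" using Suc_le_start[of i] by (simp only: of_nat_le_iff)
    have "c < ratio i" using less_ratio c t i by simp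
    then have "c * real (start i) \<le> ratio i * real (start i)" by (intro mult_right_mono) auto
    moreover have "1 \<le> (c - a) * real (start i)"
    proof -
      have "1 \<le> (c - a) * real (Suc i)" using i(3) c by (simp add: field_simps)
      also have "\<dots> \<le> (c - a) * real (start i)" using n c by (intro mult_left_mono) auto
      finally show ?thesis .
    qed
    ultimately have "a * real (start i) \<le> real (stop i)"
      using stop_bounds[of i] by (simp add: algebra_simps)
    then have *: "real (start i) * (a - 1) \<le> real (stop i - start i)"
      using start_le_stop[of i] by (simp add: algebra_simps of_nat_diff)
    have "dist_nearest_int (real B ^ start i * (pt - target i)) \<le> 1 / real B ^ (stop i - start i)"
      using start_le_stop by (intro dist_le) auto
    also have "\<dots> = real B powr (- real (stop i - start i))"
      using B_ge by (simp add: powr_minus_divide powr_realpow)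
    also have "\<dots> \<le> real B powr (- real (start i) * (a - 1))"
      using B_ge * by (intro powr_mono) auto
    finally have "dist_nearest_int (real B ^ start i * (pt - target k)) \<le> real B powr (- real (start i) * (a - 1))"
      by (simp add: t)
    moreover have "m \<le> start i" using i(1) Suc_le_start[of i] by simp
    ultimately show "\<exists>n\<ge>m. n \<in> {n. dist_nearest_int (real B ^ n * (pt - target k)) \<le> real B powr (- real n * (a - 1))}"
      by blast
  qed
qed

lemma dist_ge_powr:
  assumes "j \<ge> 1" "y \<in> {y1, y2}" "0 \<le> s" "real (stop (index j)) - real j \<le> s"
  shows "real B powr (- s - 1) \<le> dist_nearest_int (real B ^ j * (pt - y))"
proof -
  have "real (Suc (stop (index j) - j)) \<le> s + 1" using assms(3,4) by linarith
  then have "real B powr (- s - 1) \<le> real B powr (- real (Suc (stop (index j) - j)))"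
    using B_ge by (intro powr_mono) auto
  also have "\<dots> = 1 / real B ^ Suc (stop (index j) - j)"
    using B_ge by (simp add: powr_minus_divide powr_realpow del: of_nat_Suc power_Suc)
  finally show ?thesis using dist_ge[OF assms(1,2)] by linarith
qed

text \<open>In windows of ratio at most the exponent, \<open>dist_ge\<close> suffices. A longer
  window can only copy \<open>y1\<close> while the target is \<open>y2\<close>. If its remaining
  part is long, the point is so close to \<open>y1\<close> that its difference from
  \<open>y2\<close> is approximated no better than \<open>y1 - y2\<close>, which
  \<open>compat\<close> controls.\<close>

lemma approx_exponent_le_target: "approx_exponent B (pt - target k) \<le> target_exponent k"
proof (rule approx_exponent_leI)
  fix a assume a: "target_exponent k < ereal a"
  have y: "target k \<in> {y1, y2}" by (simp add: target_def)
  obtain D where D: "target_exponent k = ereal D" "D \<ge> 1"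
    using target_exponent_ge_1[of k] a by (cases "target_exponent k") (auto simp: one_ereal_def)
  \<comment> \<open>The gap between \<open>\<kappa>\<close> and \<open>a\<close> absorbs constant
    powers of \<open>B\<close>: later \<open>3 \<le> j * (a - \<kappa>)\<close>.\<close>
  define \<kappa> where "\<kappa> = (D + a) / 2"
  have \<kappa>: "D < \<kappa>" "\<kappa> < a" using a D by (auto simp: \<kappa>_def)
  have "\<forall>\<^sub>F j in sequentially. nat \<lceil>3 / (a - \<kappa>)\<rceil> + 1 \<le> j" by (rule eventually_ge_at_top)
  moreover have "\<forall>\<^sub>F j in sequentially. \<delta>1 \<noteq> \<delta>2 \<longrightarrow> odd k \<longrightarrow>
      real B powr (- real j * (\<kappa> - 1)) < dist_nearest_int (real B ^ j * (y1 - y2))"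
  proof (cases "\<delta>1 \<noteq> \<delta>2 \<and> odd k")
    case True
    then have "approx_exponent B (y1 - y2) < ereal \<kappa>"
      using compat D \<kappa> by (auto simp: target_exponent_def intro: le_less_trans)
    then show ?thesis using approx_exponent_lessD[of B "y1 - y2" \<kappa>] B_ge by (auto elim: eventually_mono)
  qed auto
  ultimately show "\<forall>\<^sub>F j in sequentially. real B powr (- real j * (a - 1)) < dist_nearest_int (real B ^ j * (pt - target k))"
  proof eventually_elim
    case (elim j)
    define i where "i = index j"
    have j1: "j \<ge> 1" and "3 / (a - \<kappa>) \<le> real j" using elim(1) by linarith+
    then have j3: "3 \<le> real j * (a - \<kappa>)" using \<kappa> by (simp add: field_simps)
    have start: "start i \<le> j" using index_bounds[OF j1] by (simp add: i_def)
    have D0: "0 \<le> real j * (D - 1)" using D by simp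
    have jD: "real j * (D - 1) + 3 \<le> real j * (a - 1)"
      using j3 mult_left_mono[of D \<kappa> "real j"] \<kappa> by (simp add: algebra_simps)
    \<comment> \<open>If at most \<open>s\<close> positions of the window remain, the distance is at
      least \<open>B powr (- s - 1)\<close>.\<close>
    have near: ?case if s: "0 \<le> s" "real (stop i) - real j \<le> s" "s + 1 < real j * (a - 1)" for s
    proof -
      have "real B powr (- real j * (a - 1)) < real B powr (- s - 1)"
        using B_ge s by (intro powr_less_mono) auto
      also have "\<dots> \<le> dist_nearest_int (real B ^ j * (pt - target k))"
        using dist_ge_powr[OF j1 y s(1)] s(2) by (simp add: i_def)
      finally show ?thesis .
    qed
    show ?case
    proof (cases "ratio i \<le> D")
      case True
      have "real (stop i) \<le> ratio i * real (start i)" by (rule stop_bounds)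
      also have "\<dots> \<le> D * real j" using True start D by (intro mult_mono) auto
      finally have "real (stop i) - real j \<le> real j * (D - 1)" by (simp add: algebra_simps)
      then show ?thesis using D0 jD by (intro near[of "real j * (D - 1)"]) auto
    next
      case False
      then have "\<not> target_exponent i \<le> target_exponent k"
        using ratio_le[of i] D by (metis ereal_less_eq(3) order_trans)
      then have par: "\<delta>1 \<noteq> \<delta>2" "odd k" "even i" "target k = y2" "target i = y1"
        using \<delta>21 by (auto simp: target_exponent_def target_def split: if_splits)
      show ?thesis
      proof (cases "real (stop i) - real j \<le> real j * (a - 1) - 2")
        case True
        then show ?thesis using D0 jD by (intro near[of "real j * (a - 1) - 2"]) auto
      next
        case False
        \<comment> \<open>\<open>X\<close> is the bound to be exceeded. The distance for
          \<open>pt - y1\<close> is at most \<open>B ^ 2 * X\<close> and that for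
          \<open>y1 - y2\<close> exceeds \<open>B ^ 3 * X\<close>, which leaves at least
          \<open>X\<close> for \<open>pt - y2\<close>.\<close>
        define X where "X = real B powr (- real j * (a - 1))"
        have X: "X > 0" using B_ge by (simp add: X_def)
        have "j \<le> stop i" using False D0 jD by linarith
        then have "dist_nearest_int (real B ^ j * (pt - y1)) \<le> 1 / real B ^ (stop i - j)"
          using dist_le[OF start] par by simp
        also have "\<dots> = real B powr (- real (stop i - j))"
          using B_ge by (simp add: powr_minus_divide powr_realpow)
        also have "\<dots> \<le> real B powr (2 + (- real j * (a - 1)))"
          using False \<open>j \<le> stop i\<close> B_ge by (intro powr_mono) (auto simp: of_nat_diff)
        also have "\<dots> = real B ^ 2 * X" unfolding X_def powr_add using B_ge by (simp add: powr_realpow[of "real B" 2, simplified])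
        finally have 1: "dist_nearest_int (real B ^ j * (pt - y1)) \<le> real B ^ 2 * X" .
        have "real B ^ 3 * X = real B powr (3 + (- real j * (a - 1)))"
          unfolding X_def powr_add using B_ge by (simp add: powr_realpow[of "real B" 3, simplified])
        also have "\<dots> \<le> real B powr (- real j * (\<kappa> - 1))"
          using j3 B_ge by (intro powr_mono) (auto simp: algebra_simps)
        also have "\<dots> < dist_nearest_int (real B ^ j * (y1 - y2))" using elim(2) par by blast
        also have "real B ^ j * (y1 - y2) = real B ^ j * (pt - y2) + - (real B ^ j * (pt - y1))"
          by (simp add: algebra_simps)
        also have "dist_nearest_int \<dots> \<le> dist_nearest_int (real B ^ j * (pt - y2)) + dist_nearest_int (real B ^ j * (pt - y1))"
          using dist_nearest_int_add[of "real B ^ j * (pt - y2)" "- (real B ^ j * (pt - y1))"]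
          by (simp add: dist_nearest_int_minus)
        finally have 2: "real B ^ 3 * X - real B ^ 2 * X < dist_nearest_int (real B ^ j * (pt - y2))"
          using 1 by linarith
        have "real B ^ 2 * (real B - 1) \<ge> 1 * 1" using B_ge by (intro mult_mono one_le_power) auto
        then have "1 * X \<le> real B ^ 2 * (real B - 1) * X" using X by (intro mult_right_mono) auto
        also have "\<dots> = real B ^ 3 * X - real B ^ 2 * X" by (simp add: algebra_simps power3_eq_cube power2_eq_square)
        finally show ?thesis using 2 par by (simp add: X_def)
      qed
    qed
  qed
qed

lemma approx_exponent_target: "approx_exponent B (pt - target k) = target_exponent k"
  by (rule antisym[OF approx_exponent_le_target approx_exponent_ge_target])

lemma approx_exponent_expansion:
  "approx_exponent B (pt - y1) = \<delta>1" "approx_exponent B (pt - y2) = \<delta>2"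
  using approx_exponent_target[of 0] approx_exponent_target[of 1]
  by (simp_all add: target_def target_exponent_def)

end

end

section \<open>Density of the free positions and the parametrisation by the unit interval\<close>

context approximation_tree
begin

definition free_count :: "nat \<Rightarrow> nat" where
  "free_count j = card {l. l < j \<and> \<not> forced l}"

lemma free_count_0: "free_count 0 = 0"
  by (simp add: free_count_def)

lemma free_count_Suc: "free_count (Suc j) = (if forced j then free_count j else Suc (free_count j))"
proof -
  have "{l. l < Suc j \<and> \<not> forced l} = (if forced j then {l. l < j \<and> \<not> forced l} else insert j {l. l < j \<and> \<not> forced l})"
    by (auto simp: less_Suc_eq)
  then show ?thesis by (simp add: free_count_def)
qed

lemma free_count_mono: "i \<le> j \<Longrightarrow> free_count i \<le> free_count j"
  unfolding free_count_def by (rule card_mono) auto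

lemma free_count_after_stop:
  assumes "stop i \<le> j" "j \<le> start (Suc i)"
  shows "free_count j = free_count (stop i) + (j - stop i)"
  using assms
proof (induction j rule: dec_induct)
  case (step n)
  then show ?case using not_forced_after_stop[of i n] by (simp add: free_count_Suc)
qed simp

text \<open>Every gap between windows contains a free position. Unboundedness of
  \<open>free_count\<close> makes parameters with the same digits equal.\<close>

lemma le_free_count_start: "i \<le> free_count (start i)"
proof (induction i)
  case (Suc i)
  also have "free_count (start i) \<le> free_count (stop i)" by (rule free_count_mono[OF start_le_stop])
  also have "\<dots> < free_count (start (Suc i))"
    using free_count_after_stop[of i "start (Suc i)"] stop_less_start[of i] by simp
  finally show ?case by simp
qed simp

text \<open>The density of free positions is lowest at the end of a window: almost all positions
  before \<open>start i\<close> are free, and \<open>stop i\<close> is at most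
  \<open>D * start i\<close>. Hence the density is asymptotically at least
  \<open>1 / D\<close>.\<close>

lemma free_count_growth:
  assumes \<delta>1: "\<delta>1 = ereal D" and \<eta>: "0 < \<eta>" "\<eta> < 1"
  shows "\<exists>J. \<forall>j\<ge>J. (1 - \<eta>) * real j \<le> D * real (free_count j)"
proof -
  \<comment> \<open>For \<open>i = Suc k \<ge> I\<close> this gives
    \<open>1 \<le> \<eta> * (k + 2)\<close>, hence
    \<open>stop k \<le> \<eta> * start i\<close>.\<close>
  define I where "I = Suc (nat \<lceil>1 / \<eta>\<rceil>)"
  have D1: "D \<ge> 1" using \<delta>2 \<delta>21 \<delta>1 by (metis ereal_less_eq(3) one_ereal_def order_trans)
  have "(1 - \<eta>) * real j \<le> D * real (free_count j)" if j: "start I \<le> j" for j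
  proof -
    define i where "i = index j"
    have "I \<le> i" using le_index[OF j] by (simp add: i_def)
    then obtain k where k: "i = Suc k" by (cases i) (auto simp: I_def)
    have "real (nat \<lceil>1 / \<eta>\<rceil>) \<le> real k" using \<open>I \<le> i\<close> k by (simp add: I_def)
    then have "1 / \<eta> \<le> real k" using real_nat_ceiling_ge[of "1 / \<eta>"] by linarith
    then have \<eta>k: "1 \<le> \<eta> * real (k + 2)" using \<eta> by (simp add: field_simps)
    have "j \<ge> 1" using j Suc_le_start[of I] by simp
    then have ij: "start i \<le> j" "j < start (Suc i)" using index_bounds by (auto simp: i_def)
    have "real (stop k) \<le> real (stop k) * (\<eta> * real (k + 2))" using \<eta>k by (simp add: mult_left_le mult_le_cancel_left1)
    also have "\<dots> \<le> \<eta> * real (start i)" using \<eta> unfolding k start_Suc by (simp add: algebra_simps)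
    finally have "real (stop k) \<le> \<eta> * real (start i)" .
    moreover have "free_count (start i) \<ge> start i - stop k"
      using free_count_after_stop[of k "start i"] stop_less_start[of k] by (simp add: k)
    then have "real (start i) - real (stop k) \<le> real (free_count (start i))" by linarith
    ultimately have fs: "(1 - \<eta>) * real (start i) \<le> real (free_count (start i))" by (simp add: algebra_simps)
    have "target_exponent i \<le> ereal D" using \<delta>21 by (simp add: target_exponent_def flip: \<delta>1)
    with ratio_le[of i] have "ereal (ratio i) \<le> ereal D" by (rule order_trans)
    then have "real (stop i) \<le> D * real (start i)"
      using stop_bounds(1)[of i] mult_right_mono[of "ratio i" D "real (start i)"] by simp
    then have "(1 - \<eta>) * real (stop i) \<le> (1 - \<eta>) * (D * real (start i))"
      using \<eta> by (intro mult_left_mono) auto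
    also have "\<dots> = D * ((1 - \<eta>) * real (start i))" by simp
    also have "\<dots> \<le> D * real (free_count (start i))" using fs D1 by (intro mult_left_mono) auto
    finally have stop: "(1 - \<eta>) * real (stop i) \<le> D * real (free_count (start i))" .
    show ?thesis
    proof (cases "j \<le> stop i")
      case True
      then have "(1 - \<eta>) * real j \<le> (1 - \<eta>) * real (stop i)" using \<eta> by (intro mult_left_mono) auto
      also note stop
      also have "D * real (free_count (start i)) \<le> D * real (free_count j)"
        using free_count_mono[OF ij(1)] D1 by (intro mult_left_mono) auto
      finally show ?thesis .
    next
      case False
      then have "real (free_count j) = real (free_count (stop i)) + (real j - real (stop i))"
        using free_count_after_stop[of i j] ij by (simp add: of_nat_diff)
      moreover have "real (free_count (start i)) \<le> real (free_count (stop i))"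
        using free_count_mono[OF start_le_stop] by simp
      ultimately have "D * (real (free_count (start i)) + (real j - real (stop i))) \<le> D * real (free_count j)"
        using D1 by (intro mult_left_mono) auto
      moreover have "(1 - \<eta>) * (real j - real (stop i)) \<le> D * (real j - real (stop i))"
        using D1 \<eta> False by (intro mult_right_mono) auto
      ultimately show ?thesis using stop by (simp add: algebra_simps)
    qed
  qed
  then show ?thesis by blast
qed

definition digit_choice :: "nat \<Rightarrow> nat \<Rightarrow> nat" where
  "digit_choice j = (SOME g. g ` {..<M} \<subseteq> allowed j \<and> inj_on g {..<M})"

lemma digit_choice: "digit_choice j ` {..<M} \<subseteq> allowed j" "inj_on (digit_choice j) {..<M}"
proof -
  have "\<exists>g. g ` {..<M} \<subseteq> allowed j \<and> inj_on g {..<M}"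
    using card_allowed[of j] finite_allowed by (intro card_le_inj) auto
  then have "digit_choice j ` {..<M} \<subseteq> allowed j \<and> inj_on (digit_choice j) {..<M}"
    unfolding digit_choice_def by (rule someI_ex)
  then show "digit_choice j ` {..<M} \<subseteq> allowed j" "inj_on (digit_choice j) {..<M}" by auto
qed

definition parameter_digit :: "nat \<Rightarrow> real \<Rightarrow> nat" where
  "parameter_digit k u = nat (\<lfloor>real M ^ Suc k * u\<rfloor> mod int M)"

text \<open>The free positions receive in turn the base \<open>M\<close> digits of \<open>u\<close>,
  encoded as allowed digits.\<close>

definition digits :: "real \<Rightarrow> nat \<Rightarrow> nat" where
  "digits u j = (if forced j then base_digit B (target (index j)) j
     else digit_choice j (parameter_digit (free_count j) u))"

lemma parameter_digit_less: "parameter_digit k u < M"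
  using M by (simp add: parameter_digit_def nat_less_iff)

lemma admissible_digits: "admissible (digits u)"
  using digit_choice(1) parameter_digit_less
  unfolding admissible_def digits_def by (metis image_subset_iff lessThan_iff)

text \<open>Forced digits do not depend on the parameter, and free ones lie between 1 and
  \<open>B - 2\<close>. This is the separation hypothesis of
  \<open>expansion_diff_ge\<close>.\<close>

lemma digits_close: "\<bar>real (digits u l) - real (digits v l)\<bar> \<le> real B - 3"
proof (cases "forced l")
  case True
  then show ?thesis using B_ge by (simp add: digits_def)
next
  case False
  then have "digits u l \<in> allowed l" "digits v l \<in> allowed l"
    using admissible_digits unfolding admissible_def by metis+
  then have "1 \<le> digits u l" "digits u l \<le> B - 2" "1 \<le> digits v l" "digits v l \<le> B - 2"
    by (auto simp: allowed_def)
  then show ?thesis using B_ge by linarith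
qed

text \<open>The encoding is injective, so the first \<open>j\<close> digits determine the first
  \<open>free_count j\<close> base \<open>M\<close> digits of the parameter.\<close>

lemma digits_agree_imp_close:
  assumes u: "u \<in> {0..<1}" and v: "v \<in> {0..<1}" and eq: "\<And>l. l < j \<Longrightarrow> digits u l = digits v l"
  shows "\<bar>u - v\<bar> \<le> 1 / real M ^ free_count j"
proof -
  have "\<lfloor>real M ^ free_count j * u\<rfloor> = \<lfloor>real M ^ free_count j * v\<rfloor>"
    using eq
  proof (induction j)
    case 0
    have "\<lfloor>u\<rfloor> = 0" "\<lfloor>v\<rfloor> = 0" using u v by (simp_all add: floor_eq_iff)
    then show ?case by (simp add: free_count_0)
  next
    case (Suc j)
    show ?case
    proof (cases "forced j")
      case True
      then show ?thesis using Suc by (simp add: free_count_Suc)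
    next
      case False
      have "digits u j = digits v j" using Suc.prems by simp
      then have "parameter_digit (free_count j) u = parameter_digit (free_count j) v"
        using False digit_choice(2)[of j] parameter_digit_less by (auto simp: digits_def dest: inj_onD)
      then have "\<lfloor>real M ^ Suc (free_count j) * u\<rfloor> mod int M = \<lfloor>real M ^ Suc (free_count j) * v\<rfloor> mod int M"
        using M unfolding parameter_digit_def by (simp add: nat_eq_iff2 del: power_Suc)
      then show ?thesis using Suc False M by (auto simp: free_count_Suc simp del: power_Suc intro: floor_power_agree)
    qed
  qed
  then have "\<bar>real M ^ free_count j * u - real M ^ free_count j * v\<bar> \<le> 1" by linarith
  then have "real M ^ free_count j * \<bar>u - v\<bar> \<le> 1" by (simp add: abs_mult flip: right_diff_distrib)
  then show ?thesis using M by (simp add: field_simps)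
qed

text \<open>If the digits first differ at \<open>j\<close>, the parameters are within
  \<open>1 / M ^ free_count j\<close> and the points at least \<open>1 / B ^ (j + 2)\<close> apart;
  \<open>growth\<close> compares the two, as the mass distribution principle requires.\<close>

lemma hausdorff_measure_tree_neq_0:
  assumes C: "C > 0" and t: "t \<ge> 0"
    and growth: "\<And>j. real B powr (t * real (j + 2)) \<le> C * real M ^ free_count j"
  shows "hausdorff_measure t {x. approx_exponent B (x - y1) = \<delta>1 \<and> approx_exponent B (x - y2) = \<delta>2} \<noteq> 0"
proof (rule hausdorff_measure_neq_0[where X = "\<lambda>u. expansion_tail B (digits u) 0", OF C t])
  show "expansion_tail B (digits u) 0 \<in> {x. approx_exponent B (x - y1) = \<delta>1 \<and> approx_exponent B (x - y2) = \<delta>2}" for u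
    using approx_exponent_expansion[OF admissible_digits] by simp
  fix u v :: real assume uv: "u \<in> {0..<1}" "v \<in> {0..<1}"
  show "\<bar>u - v\<bar> \<le> C * \<bar>expansion_tail B (digits u) 0 - expansion_tail B (digits v) 0\<bar> powr t"
  proof (cases "\<exists>j. digits u j \<noteq> digits v j")
    case True
    define j where "j = (LEAST j. digits u j \<noteq> digits v j)"
    have j: "digits u j \<noteq> digits v j" unfolding j_def using True by (rule LeastI_ex)
    have lt: "digits u l = digits v l" if "l < j" for l using that not_less_Least unfolding j_def by blast
    have B0: "real B > 1" using B_ge by simp
    have "\<bar>u - v\<bar> \<le> 1 / real M ^ free_count j" by (rule digits_agree_imp_close[OF uv lt])
    also have "\<dots> \<le> C / real B powr (t * real (j + 2))"
      using growth[of j] M B0 by (simp add: field_simps)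
    also have "\<dots> = C * (1 / real B ^ (j + 2)) powr t"
    proof -
      have "(1 / real B ^ (j + 2)) powr t = (real B powr (- real (j + 2))) powr t"
        using B0 by (simp add: powr_minus_divide powr_realpow del: of_nat_add power_add power_Suc add_2_eq_Suc' power2_eq_square)
      also have "\<dots> = 1 / real B powr (t * real (j + 2))"
        by (simp only: powr_powr powr_minus_divide[symmetric] mult_minus_left mult_minus_right mult.commute)
      finally show ?thesis by simp
    qed
    also have "\<dots> \<le> C * \<bar>expansion_tail B (digits u) 0 - expansion_tail B (digits v) 0\<bar> powr t"
      using C t B_ge j lt admissible_less[OF admissible_digits] digits_close
      by (intro mult_left_mono powr_mono2 expansion_diff_ge) auto
    finally show ?thesis .
  next
    case False
    have "\<bar>u - v\<bar> \<le> (1 / real M) ^ i" for i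
    proof -
      have "\<bar>u - v\<bar> \<le> 1 / real M ^ free_count (start i)"
        using False by (intro digits_agree_imp_close uv) auto
      also have "\<dots> \<le> 1 / real M ^ i"
        using le_free_count_start[of i] M by (intro divide_left_mono power_increasing) auto
      finally show ?thesis by (simp add: power_one_over)
    qed
    moreover have "(\<lambda>i. (1 / real M) ^ i) \<longlonglongrightarrow> 0" using M by (intro LIMSEQ_realpow_zero) auto
    ultimately have "\<bar>u - v\<bar> \<le> 0" by (intro LIMSEQ_le_const) auto
    then show ?thesis using C by simp
  qed
qed

end

section \<open>The spectrum\<close>

lemma hausdorff_dim_le:
  assumes "\<And>t. s < ereal t \<Longrightarrow> 0 \<le> t \<Longrightarrow> hausdorff_measure t A = 0" "0 \<le> s"
  shows "hausdorff_dim A \<le> s"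
proof (cases "A = {}")
  case False
  show ?thesis
  proof (rule ccontr)
    assume "\<not> hausdorff_dim A \<le> s"
    then obtain t where t: "s < ereal t" "ereal t < hausdorff_dim A"
      using ereal_dense2[of s "hausdorff_dim A"] by (auto simp: not_le)
    have "0 < ereal t" using assms(2) t(1) by (rule le_less_trans)
    then have "hausdorff_dim A \<le> ereal t"
      using False t assms(1)[of t] by (auto simp: hausdorff_dim_def intro!: Inf_lower)
    then show False using t(2) by simp
  qed
qed (simp add: hausdorff_dim_def)

lemma hausdorff_dim_ge:
  assumes "A \<noteq> {}" "\<And>t. 0 \<le> t \<Longrightarrow> ereal t < s \<Longrightarrow> hausdorff_measure t A \<noteq> 0"
  shows "s \<le> hausdorff_dim A"
proof -
  have "s \<le> Inf (ereal ` {t. 0 \<le> t \<and> hausdorff_measure t A = 0})"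
  proof (rule Inf_greatest, clarify)
    fix t assume "0 \<le> t" "hausdorff_measure t A = 0"
    then show "s \<le> ereal t" using assms(2) by (meson not_le)
  qed
  then show ?thesis using assms(1) by (simp add: hausdorff_dim_def)
qed

text \<open>From \<open>K \<ge> 4\<close> one gets \<open>b ^ K \<ge> 16\<close>, which leaves room
  for the eight excluded digits.\<close>

lemma approximation_tree_power:
  assumes "b \<ge> 2" "K \<ge> 4" "1 \<le> \<delta>2" "\<delta>2 \<le> \<delta>1" "\<delta>1 = \<delta>2 \<or> approx_exponent b (y1 - y2) \<le> \<delta>2"
  shows "approximation_tree (b ^ K) (b ^ K - 8) y1 y2 \<delta>1 \<delta>2" "b ^ K \<ge> 16"
proof -
  have "2 ^ 4 \<le> (2::nat) ^ K" using assms(2) by (intro power_increasing) auto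
  also have "\<dots> \<le> b ^ K" using assms(1) by (intro power_mono) auto
  finally show "b ^ K \<ge> 16" by simp
  then show "approximation_tree (b ^ K) (b ^ K - 8) y1 y2 \<delta>1 \<delta>2"
    using assms by unfold_locales (auto simp: approx_exponent_power)
qed

text \<open>A free position contributes a factor \<open>M\<close> instead of \<open>B\<close>. In a
  large base the loss is a small power of \<open>B\<close>, and the density \<open>1 / D\<close> of
  free positions then gives every \<open>t < 1 / D\<close>.\<close>

lemma hausdorff_measure_approx_exponents_neq_0:
  assumes b: "b \<ge> 2" and \<delta>: "1 \<le> \<delta>2" "\<delta>2 \<le> \<delta>1" "\<delta>1 = \<delta>2 \<or> approx_exponent b (y1 - y2) \<le> \<delta>2"
    and D: "\<delta>1 = ereal D" and t: "0 \<le> t" "t * D < 1"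
  shows "hausdorff_measure t {x. approx_exponent b (x - y1) = \<delta>1 \<and> approx_exponent b (x - y2) = \<delta>2} \<noteq> 0"
proof -
  have D1: "D \<ge> 1" using \<delta> D by (metis ereal_less_eq(3) one_ereal_def order_trans)
  \<comment> \<open>Then \<open>t * D = 1 - 2 * \<eta> \<le> (1 - \<eta>) * (1 - \<eta>)\<close>:
    one factor is spent on the density of free positions, the other on replacing \<open>B\<close> by
    \<open>M\<close>.\<close>
  define \<eta> where "\<eta> = (1 - t * D) / 2"
  have "0 \<le> t * D" using t D1 by simp
  then have \<eta>: "0 < \<eta>" "\<eta> < 1" using t by (auto simp: \<eta>_def)
  have "t * D \<le> (1 - \<eta>) * (1 - \<eta>)"
  proof -
    have "t * D = 1 - 2 * \<eta>" unfolding \<eta>_def by (simp add: field_simps)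
    moreover have "(1 - \<eta>) * (1 - \<eta>) = 1 - 2 * \<eta> + \<eta> * \<eta>" by (simp add: algebra_simps)
    ultimately show ?thesis using \<eta> by simp
  qed
  \<comment> \<open>This makes \<open>B powr \<eta> \<ge> b \<ge> 2\<close>, so
    \<open>B powr (1 - \<eta>) \<le> B / 2 \<le> B - 8\<close>.\<close>
  define K where "K = 4 + nat \<lceil>1 / \<eta>\<rceil>"
  define B where "B = b ^ K"
  define M where "M = B - 8"
  interpret approximation_tree B M y1 y2 \<delta>1 \<delta>2
    unfolding B_def M_def using b \<delta> by (intro approximation_tree_power) (auto simp: K_def)
  have B16: "B \<ge> 16"
    unfolding B_def using approximation_tree_power(2)[of b K \<delta>2 \<delta>1 y1 y2] b \<delta> by (simp add: K_def)
  then have B1: "real B > 1" by simp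
  have "2 \<le> real B powr \<eta>"
  proof -
    have "1 / \<eta> \<le> real K" using real_nat_ceiling_ge[of "1 / \<eta>"] by (simp add: K_def)
    then have "1 \<le> real K * \<eta>" using \<eta> by (simp add: field_simps)
    then have "real b powr 1 \<le> real b powr (real K * \<eta>)" using b by (intro powr_mono) auto
    also have "real b powr (real K * \<eta>) = real B powr \<eta>"
      using b by (simp add: B_def powr_powr flip: powr_realpow)
    finally show ?thesis using b by simp
  qed
  moreover have "real B = real B powr \<eta> * real B powr (1 - \<eta>)" using B1 by (simp flip: powr_add)
  ultimately have "2 * real B powr (1 - \<eta>) \<le> real B"
    by (metis mult_right_mono powr_ge_zero)
  then have MB: "real B powr (1 - \<eta>) \<le> real M" using B16 by (simp add: M_def of_nat_diff)
  obtain J where J: "\<And>j. j \<ge> J \<Longrightarrow> (1 - \<eta>) * real j \<le> D * real (free_count j)"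
    using free_count_growth[OF D \<eta>] by blast
  define C where "C = real B powr (t * real (J + 2))"
  have "hausdorff_measure t {x. approx_exponent B (x - y1) = \<delta>1 \<and> approx_exponent B (x - y2) = \<delta>2} \<noteq> 0"
  proof (rule hausdorff_measure_tree_neq_0)
    show "C > 0" using B1 by (simp add: C_def)
    fix j
    show "real B powr (t * real (j + 2)) \<le> C * real M ^ free_count j"
    proof (cases "j < J")
      case True
      have "real B powr (t * real (j + 2)) \<le> C * 1"
        unfolding C_def using True t B1 by (auto intro!: powr_mono mult_left_mono)
      also have "\<dots> \<le> C * real M ^ free_count j"
        using M \<open>C > 0\<close> by (intro mult_left_mono one_le_power) auto
      finally show ?thesis .
    next
      case False
      have "t * D * real j \<le> (1 - \<eta>) * (1 - \<eta>) * real j"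
        using \<open>t * D \<le> _\<close> by (rule mult_right_mono) simp
      also have "\<dots> = (1 - \<eta>) * ((1 - \<eta>) * real j)" by simp
      also have "\<dots> \<le> (1 - \<eta>) * (D * real (free_count j))"
        using J[of j] False \<eta> by (intro mult_left_mono) auto
      finally have "D * (t * real j) \<le> D * ((1 - \<eta>) * real (free_count j))" by (simp add: mult_ac)
      then have tj: "t * real j \<le> (1 - \<eta>) * real (free_count j)" using D1 by simp
      have "t * real (j + 2) \<le> t * real (J + 2) + (1 - \<eta>) * real (free_count j)"
        using tj mult_nonneg_nonneg[OF t(1), of "real J"] by (simp add: algebra_simps)
      then have "real B powr (t * real (j + 2)) \<le> real B powr (t * real (J + 2) + (1 - \<eta>) * real (free_count j))"
        using B1 by (intro powr_mono) auto
      also have "\<dots> = C * (real B powr (1 - \<eta>)) ^ free_count j"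
        using B1 by (simp add: C_def powr_add powr_power_nat)
      also have "\<dots> \<le> C * real M ^ free_count j"
        using MB \<open>C > 0\<close> by (intro mult_left_mono power_mono) auto
      finally show ?thesis .
    qed
  qed fact
  then show ?thesis unfolding B_def using b by (simp add: approx_exponent_power K_def)
qed

text \<open>The upper bound uses the larger exponent \<open>\<delta>1\<close> alone; the lower bound
  comes from the tree.\<close>

theorem hausdorff_dim_approx_exponents:
  assumes b: "b \<ge> 2" and \<delta>: "1 \<le> \<delta>2" "\<delta>2 \<le> \<delta>1" "\<delta>1 = \<delta>2 \<or> approx_exponent b (y1 - y2) \<le> \<delta>2"
  shows "hausdorff_dim {x. approx_exponent b (x - y1) = \<delta>1 \<and> approx_exponent b (x - y2) = \<delta>2} = 1 / \<delta>1"
    (is "hausdorff_dim ?A = _")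
proof (rule antisym)
  have \<delta>1: "1 \<le> \<delta>1" using \<delta> by (rule_tac order_trans)
  show "hausdorff_dim ?A \<le> 1 / \<delta>1"
  proof (rule hausdorff_dim_le)
    show "0 \<le> 1 / \<delta>1" using \<delta>1 by (cases \<delta>1) auto
    fix t assume t: "1 / \<delta>1 < ereal t" "0 \<le> t"
    have "\<exists>a>0. t * a > 1 \<and> ereal a < \<delta>1"
    proof (cases \<delta>1)
      case (real D)
      then have D1: "D \<ge> 1" using \<delta>1 by (simp add: one_ereal_def)
      then have "1 / D < t" using t(1) real by (simp add: one_ereal_def)
      then have t0: "t > 0" using D1 by (meson divide_pos_pos less_trans zero_less_one order_less_le_trans)
      then have "1 / t < D" using \<open>1 / D < t\<close> D1 by (simp add: field_simps)
      then obtain a where a: "1 / t < a" "a < D" using dense by blast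
      moreover have "a > 0" using a t0 by (meson divide_pos_pos less_trans zero_less_one)
      ultimately show ?thesis using t0 real by (intro exI[of _ a]) (auto simp: field_simps)
    next
      case PInf
      then have "t > 0" using t by simp
      then show ?thesis using PInf by (intro exI[of _ "2 / t"]) auto
    qed (use \<delta>1 in auto)
    then obtain a where a: "a > 0" "t * a > 1" "ereal a < \<delta>1" by blast
    have "hausdorff_measure t ?A \<le> hausdorff_measure t {x. ereal a < approx_exponent b (x - y1)}"
      using a by (intro hausdorff_measure_mono) auto
    then show "hausdorff_measure t ?A = 0"
      using hausdorff_measure_approx_exponent_gt_eq_0[OF b a(1,2)] by simp
  qed
  \<comment> \<open>A single point of a tree shows that the set is nonempty. For infinite
    \<open>\<delta>1\<close> this is the whole lower bound, since
    \<open>1 / \<delta>1 = 0\<close>.\<close>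
  interpret approximation_tree "b ^ 4" "b ^ 4 - 8" y1 y2 \<delta>1 \<delta>2
    using b \<delta> by (intro approximation_tree_power) auto
  have "expansion_tail (b ^ 4) (digits 0) 0 \<in> ?A"
    using approx_exponent_expansion[OF admissible_digits] b by (simp add: approx_exponent_power)
  then have "?A \<noteq> {}" by blast
  then show "1 / \<delta>1 \<le> hausdorff_dim ?A"
  proof (rule hausdorff_dim_ge)
    fix t assume t: "0 \<le> t" "ereal t < 1 / \<delta>1"
    show "hausdorff_measure t ?A \<noteq> 0"
    proof (cases \<delta>1)
      case (real D)
      then have "D \<ge> 1" using \<delta>1 by (simp add: one_ereal_def)
      then have "t * D < 1" using t(2) real by (simp add: one_ereal_def field_simps)
      then show ?thesis using hausdorff_measure_approx_exponents_neq_0[OF b \<delta> real t(1)] by simp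
    qed (use \<delta>1 t in auto)
  qed
qed

text \<open>For \<open>H = 0\<close> the equivalence rests on the \<open>ereal\<close> conventions:
  \<open>\<alpha> / 0\<close> is infinite and \<open>\<alpha>\<close> divided by infinity is
  0.\<close>

lemma ereal_divide_eq_iff_exponent:
  assumes "\<alpha> > 0" "H \<ge> 0" "1 \<le> \<Delta>"
  shows "ereal \<alpha> / \<Delta> = ereal H \<longleftrightarrow> \<Delta> = ereal \<alpha> / ereal H"
  using assms by (cases \<Delta>; cases "H = 0") (auto simp: one_ereal_def field_simps divide_ereal_def)

text \<open>The box makes both exponents at least that of \<open>y\<close>, the segment makes them
  equal; either way the compatibility condition of the tree holds.\<close>

lemma levy_regionD:
  assumes b: "b \<ge> 2" and \<alpha>: "\<alpha>1 > 0" "\<alpha>2 > 0" and H: "(H1, H2) \<in> levy_region b \<alpha>1 \<alpha>2 y"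
  shows "H1 \<ge> 0" "H2 \<ge> 0" "1 \<le> ereal \<alpha>1 / ereal H1" "1 \<le> ereal \<alpha>2 / ereal H2"
    "ereal \<alpha>1 / ereal H1 = ereal \<alpha>2 / ereal H2 \<or>
     approx_exponent b y \<le> ereal \<alpha>1 / ereal H1 \<and> approx_exponent b y \<le> ereal \<alpha>2 / ereal H2"
proof -
  have box: "H \<ge> 0 \<and> approx_exponent b y \<le> ereal \<alpha> / ereal H"
    if "H \<in> {0..real_of_ereal (ereal \<alpha> / approx_exponent b y)}" "\<alpha> > 0" for H \<alpha>
  proof (rule approx_exponent_cases[OF b, of y])
    fix D assume "approx_exponent b y = ereal D" "D \<ge> 1"
    then show ?thesis using that by (cases "H = 0") (auto simp: field_simps)
  next
    assume "approx_exponent b y = \<infinity>"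
    then show ?thesis using that by simp
  qed
  consider "H1 \<in> {0..real_of_ereal (ereal \<alpha>1 / approx_exponent b y)}" "H2 \<in> {0..real_of_ereal (ereal \<alpha>2 / approx_exponent b y)}"
    | "0 \<le> H1" "H1 \<le> \<alpha>1" "H2 = \<alpha>2 / \<alpha>1 * H1"
    using H by (auto simp: levy_region_def)
  then have "H1 \<ge> 0 \<and> H2 \<ge> 0 \<and> 1 \<le> ereal \<alpha>1 / ereal H1 \<and> 1 \<le> ereal \<alpha>2 / ereal H2 \<and>
    (ereal \<alpha>1 / ereal H1 = ereal \<alpha>2 / ereal H2 \<or>
     approx_exponent b y \<le> ereal \<alpha>1 / ereal H1 \<and> approx_exponent b y \<le> ereal \<alpha>2 / ereal H2)"
  proof cases
    case 1
    then show ?thesis using box[OF _ \<alpha>(1)] box[OF _ \<alpha>(2)] order_trans[OF approx_exponent_ge_1[OF b, of y]] by blast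
  next
    case 2
    show ?thesis
    proof (cases "H1 = 0")
      case True
      then show ?thesis using 2 \<alpha> by simp
    next
      case False
      have "H2 > 0" unfolding 2(3) using 2 False \<alpha> by simp
      moreover have "\<alpha>2 / H2 = \<alpha>1 / H1" unfolding 2(3) using False \<alpha> by simp
      moreover have "1 \<le> \<alpha>1 / H1" using 2 False by simp
      ultimately show ?thesis using 2(1) False by (simp add: one_ereal_def)
    qed
  qed
  then show "H1 \<ge> 0" "H2 \<ge> 0" "1 \<le> ereal \<alpha>1 / ereal H1" "1 \<le> ereal \<alpha>2 / ereal H2"
    "ereal \<alpha>1 / ereal H1 = ereal \<alpha>2 / ereal H2 \<or>
     approx_exponent b y \<le> ereal \<alpha>1 / ereal H1 \<and> approx_exponent b y \<le> ereal \<alpha>2 / ereal H2" by blast+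
qed

theorem theorem2p3:
  fixes b :: nat and \<alpha>1 \<alpha>2 y H1 H2 :: real
  assumes "b \<ge> 2" and "\<alpha>1 > 0" and "\<alpha>2 > 0"
  shows "((H1, H2) \<in> levy_region b \<alpha>1 \<alpha>2 y \<longrightarrow>
            bivariate_spectrum (levy b \<alpha>1) (levy_translated b \<alpha>2 y) H1 H2
              = ereal (min (H1 / \<alpha>1) (H2 / \<alpha>2)))
       \<and> ((H1, H2) \<notin> {0..\<alpha>1} \<times> {0..\<alpha>2} \<longrightarrow>
            bivariate_spectrum (levy b \<alpha>1) (levy_translated b \<alpha>2 y) H1 H2 = -\<infinity>)"
proof (intro conjI impI)
  have spectrum: "bivariate_spectrum (levy b \<alpha>1) (levy_translated b \<alpha>2 y) H1 H2 =
      hausdorff_dim {x. ereal \<alpha>1 / approx_exponent b x = ereal H1 \<and> ereal \<alpha>2 / approx_exponent b (x - y) = ereal H2}"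
    unfolding bivariate_spectrum_def using assms by (simp add: holder_exponent_levy holder_exponent_levy_translated)
  {
    assume "(H1, H2) \<in> levy_region b \<alpha>1 \<alpha>2 y"
    note H = levy_regionD[OF assms this]
    define e1 e2 where "e1 = ereal \<alpha>1 / ereal H1" and "e2 = ereal \<alpha>2 / ereal H2"
    note e = e1_def e2_def
    note e12 = H(3-5)[folded e]
    have "bivariate_spectrum (levy b \<alpha>1) (levy_translated b \<alpha>2 y) H1 H2 =
        hausdorff_dim {x. approx_exponent b (x - 0) = e1 \<and> approx_exponent b (x - y) = e2}"
      unfolding spectrum using assms H(1,2) approx_exponent_ge_1[OF assms(1)]
      by (simp add: ereal_divide_eq_iff_exponent e)
    also have "\<dots> = 1 / max e1 e2"
    \<comment> \<open>The larger exponent has to come first, so the points 0 and \<open>y\<close>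
      change roles in the second case. Their difference is \<open>- y\<close> or \<open>y\<close>,
      with the same approximation exponent.\<close>
    proof (cases "e2 \<le> e1")
      case True
      then have "hausdorff_dim {x. approx_exponent b (x - 0) = e1 \<and> approx_exponent b (x - y) = e2} = 1 / e1"
        using e12 assms by (intro hausdorff_dim_approx_exponents) (auto simp: approx_exponent_minus)
      then show ?thesis using True by (simp add: max_def)
    next
      case False
      then have "hausdorff_dim {x. approx_exponent b (x - y) = e2 \<and> approx_exponent b (x - 0) = e1} = 1 / e2"
        using e12 assms by (intro hausdorff_dim_approx_exponents) auto
      moreover have "max e1 e2 = e2" using False by simp
      ultimately show ?thesis by (simp add: conj_commute)
    qed
    also have "\<dots> = ereal (min (H1 / \<alpha>1) (H2 / \<alpha>2))"
      using H(1,2) assms unfolding e by (cases "H1 = 0"; cases "H2 = 0")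
        (auto simp: max_def min_def one_ereal_def divide_ereal_def field_simps)
    finally show "bivariate_spectrum (levy b \<alpha>1) (levy_translated b \<alpha>2 y) H1 H2 = ereal (min (H1 / \<alpha>1) (H2 / \<alpha>2))" .
  }
  assume out: "(H1, H2) \<notin> {0..\<alpha>1} \<times> {0..\<alpha>2}"
  \<comment> \<open>Approximation exponents are at least 1, so both Hoelder exponents stay in the
    rectangle and the level set outside it is empty.\<close>
  have range: "0 \<le> H \<and> H \<le> \<alpha>" if "ereal \<alpha> / approx_exponent b x = ereal H" "\<alpha> > 0" for x \<alpha> H
  proof (rule approx_exponent_cases[OF assms(1), of x])
    fix D assume D: "approx_exponent b x = ereal D" "D \<ge> 1"
    then have "H = \<alpha> / D" using that by simp
    then show ?thesis using D that by (simp add: divide_le_eq mult_le_cancel_left1)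
  next
    assume "approx_exponent b x = \<infinity>"
    then show ?thesis using that by simp
  qed
  have "{x. ereal \<alpha>1 / approx_exponent b x = ereal H1 \<and> ereal \<alpha>2 / approx_exponent b (x - y) = ereal H2} = {}"
    using range[of \<alpha>1 _ H1] range[of \<alpha>2 _ H2] out assms by auto
  then show "bivariate_spectrum (levy b \<alpha>1) (levy_translated b \<alpha>2 y) H1 H2 = -\<infinity>"
    unfolding spectrum hausdorff_dim_def by simp
qed

end
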